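(* Let $M$ be a complete Riemannian manifold. Let $x_0$ be a fixed point of a $C^1$ function $G:M\to M$ satisfying the following condition: $$\langle h,dG(x_0)(h)\rangle\le K<1\quad\text{for every } \|h\|=1.$$ Then there exists a positive $\delta$ such that for every differentiable mapping $H:M\to M$ such that $\|dH(y)-L_{yH(y)}\|<\delta$ for every $y$ near $x_0$, the composition $H\circ G:M\to M$ has a fixed point provided that $d(x_0,H(x_0))<\delta$.
   Context: Riemannian manifolds are modelled on a real Hilbert space (finite or infinite dimensional); $d$ is the Riemannian distance and $TM_x$ the tangent space at $x$. $K$ is a constant and $h$ ranges over $TM_{x_0}$, with the Riemannian inner product $\langle\cdot,\cdot\rangle$ and norm. $L_{xy}:TM_x\to TM_y$ is the parallel transport along the minimizing geodesic joining $x$ to $y$. Norms of linear maps between tangent spaces are operator norms. *)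

theory Defs
  imports "HOL-Analysis.Analysis"
begin

definition bounded_multilinear ::
    "nat \<Rightarrow> ('a::real_normed_vector list \<Rightarrow> 'b::real_normed_vector) \<Rightarrow> bool" where
  "bounded_multilinear n F \<longleftrightarrow>
     (\<forall>vs i. length vs = n \<and> i < n \<longrightarrow> linear (\<lambda>v. F (vs[i := v]))) \<and>
     (\<exists>C. \<forall>vs. length vs = n \<longrightarrow> norm (F vs) \<le> C * prod_list (map norm vs))"

text \<open>
  Meant for open \<open>S\<close>. \<open>D n x\<close> is the \<open>n\<close>-th derivative at \<open>x\<close>, a bounded \<open>n\<close>-linear map (only its
  values on lists of length \<open>n\<close> matter), and \<open>D (Suc n)\<close> is the Frechet derivative of \<open>D n\<close> with
  respect to the operator norm on \<open>n\<close>-linear maps. The successive derivatives live in ever larger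
  spaces of operators, so they cannot be iterated inside a single type.
\<close>
definition smooth_on ::
    "'a::real_normed_vector set \<Rightarrow> ('a \<Rightarrow> 'b::real_normed_vector) \<Rightarrow> bool" where
  "smooth_on S f \<longleftrightarrow>
     (\<exists>D :: nat \<Rightarrow> 'a \<Rightarrow> 'a list \<Rightarrow> 'b.
        (\<forall>x\<in>S. D 0 x [] = f x) \<and>
        (\<forall>n. \<forall>x\<in>S. bounded_multilinear n (D n x)) \<and>
        (\<forall>n. \<forall>x\<in>S. \<forall>e>0. \<exists>d>0. \<forall>y\<in>S. norm (y - x) < d \<longrightarrow>
           (\<forall>vs. length vs = n \<longrightarrow>
              norm (D n y vs - D n x vs - D (Suc n) x ((y - x) # vs))
                \<le> e * norm (y - x) * prod_list (map norm vs))))"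

text \<open>
  A chart is a domain together with a coordinate map, whose values outside the domain are
  irrelevant. The manifold is the whole type \<open>'m\<close>.
\<close>
type_synonym ('m, 'h) chart = "'m set \<times> ('m \<Rightarrow> 'h)"

definition chart_inv :: "('m, 'h) chart \<Rightarrow> 'h \<Rightarrow> 'm" where
  "chart_inv c = inv_into (fst c) (snd c)"

definition charts_at :: "('m, 'h) chart set \<Rightarrow> 'm \<Rightarrow> ('m, 'h) chart set" where
  "charts_at A x = {c \<in> A. x \<in> fst c}"

definition smooth_atlas :: "('m::t2_space, 'h::{real_inner,banach}) chart set \<Rightarrow> bool" where
  "smooth_atlas A \<longleftrightarrow>
     (\<Union>c\<in>A. fst c) = UNIV \<and>
     (\<forall>c\<in>A. open (fst c) \<and> open (snd c ` fst c) \<and>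
        homeomorphism (fst c) (snd c ` fst c) (snd c) (chart_inv c)) \<and>
     (\<forall>c\<in>A. \<forall>d\<in>A. smooth_on (snd c ` (fst c \<inter> fst d)) (snd d \<circ> chart_inv c))"

text \<open>
  A tangent vector at \<open>x\<close> is the family of its coordinate vectors in all charts around \<open>x\<close>; they
  transform by the derivatives of the chart transitions. The value at any other chart is
  normalised to \<open>0\<close>. Addition and scalar multiplication are pointwise.
\<close>
type_synonym ('m, 'h) tvector = "('m, 'h) chart \<Rightarrow> 'h"

definition tangent_space ::
    "('m, 'h::{real_inner,banach}) chart set \<Rightarrow> 'm \<Rightarrow> ('m, 'h) tvector set" where
  "tangent_space A x =
     {v. (\<forall>c\<in>charts_at A x. \<forall>d\<in>charts_at A x.
            v d = frechet_derivative (snd d \<circ> chart_inv c) (at (snd c x)) (v c)) \<and>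
         (\<forall>c. c \<notin> charts_at A x \<longrightarrow> v c = 0)}"

text \<open>The tangent vector at \<open>x\<close> with coordinate vector \<open>u\<close> in the chart \<open>c\<close> around \<open>x\<close>.\<close>
definition tvector_of ::
    "('m, 'h::{real_inner,banach}) chart set \<Rightarrow> ('m, 'h) chart \<Rightarrow> 'm \<Rightarrow> 'h \<Rightarrow> ('m, 'h) tvector" where
  "tvector_of A c x u = (\<lambda>d. if d \<in> charts_at A x
     then frechet_derivative (snd d \<circ> chart_inv c) (at (snd c x)) u else 0)"

definition map_rep ::
    "('m \<Rightarrow> 'm) \<Rightarrow> ('m, 'h) chart \<Rightarrow> ('m, 'h) chart \<Rightarrow> 'h \<Rightarrow> 'h" where
  "map_rep F c d = snd d \<circ> F \<circ> chart_inv c"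

definition differentiable_map ::
    "('m::t2_space, 'h::{real_inner,banach}) chart set \<Rightarrow> ('m \<Rightarrow> 'm) \<Rightarrow> bool" where
  "differentiable_map A F \<longleftrightarrow> continuous_on UNIV F \<and>
     (\<forall>x. \<forall>c\<in>charts_at A x. \<forall>d\<in>charts_at A (F x).
        map_rep F c d differentiable (at (snd c x)))"

definition C1_map ::
    "('m::t2_space, 'h::{real_inner,banach}) chart set \<Rightarrow> ('m \<Rightarrow> 'm) \<Rightarrow> bool" where
  "C1_map A F \<longleftrightarrow> continuous_on UNIV F \<and>
     (\<forall>c\<in>A. \<forall>d\<in>A. \<exists>D :: 'h \<Rightarrow> 'h \<Rightarrow>\<^sub>L 'h.
        continuous_on (snd c ` (fst c \<inter> F -` fst d)) D \<and>
        (\<forall>p \<in> snd c ` (fst c \<inter> F -` fst d).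
           (map_rep F c d has_derivative blinfun_apply (D p)) (at p)))"

text \<open>By the chain rule the result does not depend on the chart chosen around \<open>x\<close>.\<close>
definition differential ::
    "('m, 'h::{real_inner,banach}) chart set \<Rightarrow> ('m \<Rightarrow> 'm) \<Rightarrow> 'm
      \<Rightarrow> ('m, 'h) tvector \<Rightarrow> ('m, 'h) tvector" where
  "differential A F x v =
     (let c = (SOME c. c \<in> charts_at A x) in
      (\<lambda>d. if d \<in> charts_at A (F x)
         then frechet_derivative (map_rep F c d) (at (snd c x)) (v c) else 0))"

type_synonym ('m, 'h) metric = "'m \<Rightarrow> ('m, 'h) tvector \<Rightarrow> ('m, 'h) tvector \<Rightarrow> real"

text \<open>
  Each \<open>g x\<close> is an inner product on the tangent space at \<open>x\<close> defining its Hilbert space topology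
  (the lower bound; the upper one is boundedness of \<open>B\<close>), and it depends smoothly on \<open>x\<close>.
\<close>
definition riemannian_manifold ::
    "('m::t2_space, 'h::{real_inner,banach}) chart set \<Rightarrow> ('m, 'h) metric \<Rightarrow> bool" where
  "riemannian_manifold A g \<longleftrightarrow> smooth_atlas A \<and>
     (\<forall>c\<in>A. \<exists>B :: 'h \<Rightarrow> 'h \<Rightarrow>\<^sub>L 'h \<Rightarrow>\<^sub>L real.
        smooth_on (snd c ` fst c) B \<and>
        (\<forall>x\<in>fst c. \<forall>v\<in>tangent_space A x. \<forall>w\<in>tangent_space A x.
           g x v w = blinfun_apply (blinfun_apply (B (snd c x)) (v c)) (w c)) \<and>
        (\<forall>p \<in> snd c ` fst c.
           (\<forall>u v. blinfun_apply (blinfun_apply (B p) u) v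
              = blinfun_apply (blinfun_apply (B p) v) u) \<and>
           (\<exists>k>0. \<forall>u. k * (norm u)\<^sup>2 \<le> blinfun_apply (blinfun_apply (B p) u) u)))"

definition rnorm :: "('m, 'h) metric \<Rightarrow> 'm \<Rightarrow> ('m, 'h) tvector \<Rightarrow> real" where
  "rnorm g x v = sqrt (g x v v)"

definition op_norm ::
    "('m, 'h::{real_inner,banach}) chart set \<Rightarrow> ('m, 'h) metric \<Rightarrow> 'm \<Rightarrow> 'm
      \<Rightarrow> (('m, 'h) tvector \<Rightarrow> ('m, 'h) tvector) \<Rightarrow> real" where
  "op_norm A g x y T = (SUP v \<in> {v \<in> tangent_space A x. rnorm g x v \<le> 1}. rnorm g y (T v))"

definition C1_curve_on ::
    "('m::t2_space, 'h::{real_inner,banach}) chart set \<Rightarrow> real \<Rightarrow> real \<Rightarrow> (real \<Rightarrow> 'm) \<Rightarrow> bool" where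
  "C1_curve_on A a b \<gamma> \<longleftrightarrow> continuous_on {a..b} \<gamma> \<and>
     (\<forall>c\<in>A. \<exists>D. continuous_on ({a..b} \<inter> \<gamma> -` fst c) D \<and>
        (\<forall>t \<in> {a..b} \<inter> \<gamma> -` fst c.
           ((snd c \<circ> \<gamma>) has_vector_derivative D t) (at t within {a..b})))"

text \<open>
  The one-sided derivatives at the break points are required to exist and to be limits of the
  derivatives nearby; otherwise the speed of \<open>\<gamma>\<close> might fail to be integrable.
\<close>
definition piecewise_C1_curve ::
    "('m::t2_space, 'h::{real_inner,banach}) chart set \<Rightarrow> (real \<Rightarrow> 'm) \<Rightarrow> bool" where
  "piecewise_C1_curve A \<gamma> \<longleftrightarrow>
     (\<exists>S. finite S \<and> {0, 1} \<subseteq> S \<and> S \<subseteq> {0..1} \<and>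
        (\<forall>a\<in>S. \<forall>b\<in>S. a < b \<and> {a<..<b} \<inter> S = {} \<longrightarrow> C1_curve_on A a b \<gamma>))"

definition velocity ::
    "('m, 'h::{real_inner,banach}) chart set \<Rightarrow> (real \<Rightarrow> 'm) \<Rightarrow> real \<Rightarrow> ('m, 'h) tvector" where
  "velocity A \<gamma> t = (\<lambda>c. if c \<in> charts_at A (\<gamma> t)
     then vector_derivative (snd c \<circ> \<gamma>) (at t within {0..1}) else 0)"

definition curve_length ::
    "('m, 'h::{real_inner,banach}) chart set \<Rightarrow> ('m, 'h) metric \<Rightarrow> (real \<Rightarrow> 'm) \<Rightarrow> real" where
  "curve_length A g \<gamma> = integral {0..1} (\<lambda>t. rnorm g (\<gamma> t) (velocity A \<gamma> t))"

text \<open>Points in different components of the manifold are at distance \<open>\<infinity>\<close>.\<close>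
definition rdist ::
    "('m::t2_space, 'h::{real_inner,banach}) chart set \<Rightarrow> ('m, 'h) metric \<Rightarrow> 'm \<Rightarrow> 'm \<Rightarrow> ennreal" where
  "rdist A g x y =
     (INF \<gamma> \<in> {\<gamma>. piecewise_C1_curve A \<gamma> \<and> \<gamma> 0 = x \<and> \<gamma> 1 = y}. ennreal (curve_length A g \<gamma>))"

definition complete_riemannian_manifold ::
    "('m::t2_space, 'h::{real_inner,banach}) chart set \<Rightarrow> ('m, 'h) metric \<Rightarrow> bool" where
  "complete_riemannian_manifold A g \<longleftrightarrow> riemannian_manifold A g \<and>
     (\<forall>X. (\<forall>e>0. \<exists>N::nat. \<forall>m\<ge>N. \<forall>n\<ge>N. rdist A g (X m) (X n) < ennreal e) \<longrightarrow>
          (\<exists>x. (\<lambda>n. rdist A g (X n) x) \<longlonglongrightarrow> 0))"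

definition coord_metric ::
    "('m, 'h::{real_inner,banach}) chart set \<Rightarrow> ('m, 'h) metric \<Rightarrow> ('m, 'h) chart
      \<Rightarrow> 'h \<Rightarrow> 'h \<Rightarrow> 'h \<Rightarrow> real" where
  "coord_metric A g c p u v =
     (let x = chart_inv c p in g x (tvector_of A c x u) (tvector_of A c x v))"

text \<open>
  \<open>z\<close> is the value \<open>\<Gamma>(p)(u, v)\<close> of the Christoffel symbol of the Levi-Civita connection in the chart
  \<open>c\<close>, so that the covariant derivative of \<open>V\<close> in the direction \<open>u\<close> is \<open>DV(u) + \<Gamma>(u, V)\<close>. The
  equation is the Koszul formula for constant fields; it determines \<open>z\<close> uniquely as the metric is
  positive definite, and \<open>z\<close> exists by the Riesz representation theorem.
\<close>
definition is_christoffel ::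
    "('m, 'h::{real_inner,banach}) chart set \<Rightarrow> ('m, 'h) metric \<Rightarrow> ('m, 'h) chart
      \<Rightarrow> 'h \<Rightarrow> 'h \<Rightarrow> 'h \<Rightarrow> 'h \<Rightarrow> bool" where
  "is_christoffel A g c p u v z \<longleftrightarrow>
     (let dg = (\<lambda>a b e. frechet_derivative (\<lambda>q. coord_metric A g c q b e) (at p) a) in
      \<forall>w. 2 * coord_metric A g c p z w = dg u v w + dg v u w - dg w u v)"

definition parallel_along ::
    "('m, 'h::{real_inner,banach}) chart set \<Rightarrow> ('m, 'h) metric \<Rightarrow> (real \<Rightarrow> 'm)
      \<Rightarrow> (real \<Rightarrow> ('m, 'h) tvector) \<Rightarrow> bool" where
  "parallel_along A g \<gamma> V \<longleftrightarrow>
     (\<forall>t\<in>{0..1}. V t \<in> tangent_space A (\<gamma> t) \<and>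
        (\<forall>c\<in>charts_at A (\<gamma> t). \<exists>z.
           is_christoffel A g c (snd c (\<gamma> t)) (velocity A \<gamma> t c) (V t c) z \<and>
           ((\<lambda>s. V s c) has_vector_derivative - z) (at t within {0..1})))"

definition minimizing_geodesic ::
    "('m::t2_space, 'h::{real_inner,banach}) chart set \<Rightarrow> ('m, 'h) metric \<Rightarrow> 'm \<Rightarrow> 'm
      \<Rightarrow> (real \<Rightarrow> 'm) \<Rightarrow> bool" where
  "minimizing_geodesic A g x y \<gamma> \<longleftrightarrow>
     C1_curve_on A 0 1 \<gamma> \<and> \<gamma> 0 = x \<and> \<gamma> 1 = y \<and>
     parallel_along A g \<gamma> (velocity A \<gamma>) \<and>
     ennreal (curve_length A g \<gamma>) = rdist A g x y"

text \<open>
  \<open>L\<close> is the parallel transport from \<open>x\<close> to \<open>y\<close> along a minimizing geodesic. This is a relation because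
  that geodesic need not exist or be unique unless \<open>x\<close> and \<open>y\<close> are close; where it is unique, so is
  \<open>L\<close> on the tangent space at \<open>x\<close>.
\<close>
definition is_parallel_transport ::
    "('m::t2_space, 'h::{real_inner,banach}) chart set \<Rightarrow> ('m, 'h) metric \<Rightarrow> 'm \<Rightarrow> 'm
      \<Rightarrow> (('m, 'h) tvector \<Rightarrow> ('m, 'h) tvector) \<Rightarrow> bool" where
  "is_parallel_transport A g x y L \<longleftrightarrow>
     (\<exists>\<gamma>. minimizing_geodesic A g x y \<gamma> \<and>
        (\<forall>v\<in>tangent_space A x. \<exists>V. parallel_along A g \<gamma> V \<and> V 0 = v \<and> V 1 = L v))"

end

theory Submission
  imports Defs
begin

text \<open>
  The whole argument takes place in one chart around \<open>x\<^sub>0\<close>. On a small coordinate ball the norm of the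
  model space is equivalent to the Riemannian norms and the Christoffel symbols are bounded
  (\<open>controlled_chart_ball\<close>), so lengths and parallel transport can be compared with their flat
  counterparts.

  A short minimizing geodesic that starts well inside the ball stays in it
  (\<open>short_geodesic_confined\<close>). Parallel transport along it solves the linear equation
  \<open>V' = - \<Gamma>(\<gamma>', V)\<close>, in which the integral of \<open>norm \<gamma>'\<close> is small; hence it is close to the identity in
  coordinates (\<open>parallel_transport_near_identity\<close>). The hypothesis on \<open>H\<close> therefore says that the
  coordinate derivative of \<open>H\<close> is close to the identity at every point of a small ball that \<open>H\<close>
  maps into this ball (\<open>map_derivative_near_identity\<close>). That the points near \<open>x\<^sub>0\<close> are such points is clear for \<open>x\<^sub>0\<close>
  itself, because \<open>H x\<^sub>0\<close> is the end of a short geodesic. For the others one follows the segment from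
  \<open>x\<^sub>0\<close>: as long as its image stays in the ball, \<open>H\<close> is 2-Lipschitz along it, and this bound is what
  prevents the image from leaving (\<open>image_confined\<close>). Closed balls of an infinite-dimensional space
  are not compact, so that a curve does not leave a ball has to be deduced from the completeness of
  the model space and the Hausdorff property of the manifold (\<open>curve_confined_to_chart_ball\<close>).

  In coordinates, \<open>F = H \<circ> G\<close> thus nearly fixes \<open>x\<^sub>0\<close>, and its derivative near \<open>x\<^sub>0\<close> is close to
  \<open>T = dG(x\<^sub>0)\<close>. The map \<open>F\<close> need not be a contraction, since \<open>K < 1\<close> does not bound \<open>T\<close> from below and
  says nothing about its skew part. But \<open>1 - T\<close> is strictly monotone for the inner product at \<open>x\<^sub>0\<close>:
  \<open>\<langle>h, (1 - T) h\<rangle> \<ge> (1 - K) \<langle>h, h\<rangle>\<close>. For small \<open>s > 0\<close> the relaxed map \<open>x - s (x - F x)\<close>, which has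
  the same fixed points, is therefore a contraction in the norm at \<open>x\<^sub>0\<close>, as
  \<open>\<parallel>h - s (1 - T) h\<parallel>\<^sup>2 \<le> (1 - 2 s (1 - K) + O(s\<^sup>2)) \<parallel>h\<parallel>\<^sup>2\<close>, and Banach's theorem applies
  (\<open>fixed_point_if_derivative_near\<close>). All radii are determined by the metric, \<open>G\<close> and \<open>U\<close> before
  \<open>\<delta>\<close> is chosen, so \<open>\<delta>\<close> can make the displacement of \<open>x\<^sub>0\<close> under \<open>H\<close> small relative to them.
\<close>


section \<open>Smooth maps in the operator norm\<close>

text \<open>
  The bilinear bound on the second derivative, together with its approximation property, makes the
  first derivative locally Lipschitz in the operator norm. This uniformity in the direction cannot
  be read off from the derivatives evaluated at fixed vectors.
\<close>
lemma smooth_on_imp_C1: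
  fixes f :: "'a::real_normed_vector \<Rightarrow> 'b::real_normed_vector"
  assumes "smooth_on S f" and "open S"
  obtains D :: "'a \<Rightarrow> 'a \<Rightarrow>\<^sub>L 'b"
  where "continuous_on S D" and "\<And>x. x \<in> S \<Longrightarrow> (f has_derivative D x) (at x)"
proof -
  obtain D :: "nat \<Rightarrow> 'a \<Rightarrow> 'a list \<Rightarrow> 'b" where
    D0: "\<And>x. x \<in> S \<Longrightarrow> D 0 x [] = f x" and
    ml: "\<And>n x. x \<in> S \<Longrightarrow> bounded_multilinear n (D n x)" and
    dD: "\<And>n x e. x \<in> S \<Longrightarrow> 0 < e \<Longrightarrow> \<exists>d>0. \<forall>y\<in>S. norm (y - x) < d \<longrightarrow>
           (\<forall>vs. length vs = n \<longrightarrow>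
              norm (D n y vs - D n x vs - D (Suc n) x ((y - x) # vs))
                \<le> e * norm (y - x) * prod_list (map norm vs))"
    using assms(1) unfolding smooth_on_def by metis
  define D' where "D' x = Blinfun (\<lambda>v. D 1 x [v])" for x
  have bl: "bounded_linear (\<lambda>v. D 1 x [v])" if x: "x \<in> S" for x
  proof -
    have "\<And>vs i. length vs = Suc 0 \<Longrightarrow> i < 1 \<Longrightarrow> linear (\<lambda>v. D 1 x (vs[i := v]))"
      using ml[OF x, of 1] unfolding bounded_multilinear_def by auto
    from this[of "[0]" 0] have "linear (\<lambda>v. D 1 x [v])"
      by simp
    moreover obtain C where C: "\<And>vs. length vs = 1 \<Longrightarrow> norm (D 1 x vs) \<le> C * prod_list (map norm vs)"
      using ml[OF x, of 1] unfolding bounded_multilinear_def by auto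
    have "norm (D 1 x [v]) \<le> norm v * C" for v
      using C[of "[v]"] by (simp add: mult.commute)
    ultimately show ?thesis
      by (intro bounded_linear.intro bounded_linear_axioms.intro) auto
  qed
  have app: "blinfun_apply (D' x) v = D 1 x [v]" if "x \<in> S" for x v
    unfolding D'_def using bounded_linear_Blinfun_apply[OF bl[OF that]] by simp
  have "(f has_derivative D' x) (at x)" if x: "x \<in> S" for x
    unfolding has_derivative_at_alt
  proof (intro conjI allI impI)
    show "bounded_linear (blinfun_apply (D' x))" by (rule blinfun.bounded_linear_right)
    fix e :: real assume "0 < e"
    then obtain d where d: "d > 0" and
      dd: "\<And>y. y \<in> S \<Longrightarrow> norm (y - x) < d \<Longrightarrow> norm (D 0 y [] - D 0 x [] - D 1 x [y - x]) \<le> e * norm (y - x)"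
      using dD[OF x, of e 0] by auto
    obtain r where r: "r > 0" "ball x r \<subseteq> S"
      using assms(2) x by (meson open_contains_ball)
    have "norm (f y - f x - D' x (y - x)) \<le> e * norm (y - x)" if "norm (y - x) < min d r" for y
    proof -
      have "y \<in> S" using that r by (auto simp: dist_norm norm_minus_commute)
      then show ?thesis using dd[of y] that D0 x app by simp
    qed
    then show "\<exists>d>0. \<forall>y. norm (y - x) < d \<longrightarrow> norm (f y - f x - blinfun_apply (D' x) (y - x)) \<le> e * norm (y - x)"
      using d r by (intro exI[of _ "min d r"]) auto
  qed
  moreover have "continuous_on S D'"
    unfolding continuous_on_iff
  proof (intro ballI allI impI)
    fix x and e :: real assume x: "x \<in> S" and e: "0 < e"
    obtain C where C: "\<And>vs. length vs = 2 \<Longrightarrow> norm (D 2 x vs) \<le> C * prod_list (map norm vs)"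
      using ml[OF x, of 2] unfolding bounded_multilinear_def by auto
    obtain d where d: "d > 0" and
      d': "\<forall>y\<in>S. norm (y - x) < d \<longrightarrow> (\<forall>vs. length vs = 1 \<longrightarrow>
        norm (D 1 y vs - D 1 x vs - D (Suc 1) x ((y - x) # vs)) \<le> 1 * norm (y - x) * prod_list (map norm vs))"
      using dD[OF x zero_less_one, of 1] by blast
    have dd: "norm (D 1 y [v] - D 1 x [v] - D 2 x [y - x, v]) \<le> norm (y - x) * norm v"
      if "y \<in> S" "norm (y - x) < d" for y v
      using d'[rule_format, OF that, of "[v]"] by (simp add: numeral_2_eq_2)
    have lip: "norm (D' y - D' x) \<le> (\<bar>C\<bar> + 1) * norm (y - x)" if y: "y \<in> S" "norm (y - x) < d" for y
    proof (rule norm_blinfun_bound)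
      fix v
      have "norm (D 1 y [v] - D 1 x [v])
          \<le> norm (D 1 y [v] - D 1 x [v] - D 2 x [y - x, v]) + norm (D 2 x [y - x, v])"
        by (metis diff_add_cancel norm_triangle_ineq)
      also have "\<dots> \<le> norm (y - x) * norm v + \<bar>C\<bar> * (norm (y - x) * norm v)"
      proof (intro add_mono dd y)
        have "norm (D 2 x [y - x, v]) \<le> C * (norm (y - x) * norm v)"
          using C[of "[y - x, v]"] by simp
        also have "\<dots> \<le> \<bar>C\<bar> * (norm (y - x) * norm v)"
          by (intro mult_right_mono) auto
        finally show "norm (D 2 x [y - x, v]) \<le> \<bar>C\<bar> * (norm (y - x) * norm v)" .
      qed
      finally show "norm (blinfun_apply (D' y - D' x) v) \<le> (\<bar>C\<bar> + 1) * norm (y - x) * norm v"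
        using app x y by (simp add: blinfun.diff_left algebra_simps)
    qed simp
    show "\<exists>d>0. \<forall>x'\<in>S. dist x' x < d \<longrightarrow> dist (D' x') (D' x) < e"
    proof (intro exI[of _ "min d (e / (\<bar>C\<bar> + 1))"] conjI ballI impI)
      show "0 < min d (e / (\<bar>C\<bar> + 1))" using d e by auto
      fix y assume y: "y \<in> S" "dist y x < min d (e / (\<bar>C\<bar> + 1))"
      then have "norm (y - x) < d" and "(\<bar>C\<bar> + 1) * norm (y - x) < e"
        by (auto simp: dist_norm pos_less_divide_eq mult.commute)
      then show "dist (D' y) (D' x) < e" using lip[OF y(1)] by (simp add: dist_norm)
    qed
  qed
  ultimately show thesis using that by blast
qed

section \<open>Fixed points for strictly monotone perturbations of the identity\<close>

text \<open>
  A second inner product on the model space, here the Riemannian one at a point read in a chart.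
  The contraction estimate holds only in its norm, whereas derivatives and completeness refer to the
  norm of the type; \<open>k\<close> is the lower constant of the equivalence, and boundedness of \<open>b\<close> gives the
  upper one.
\<close>
locale equivalent_inner_product =
  fixes b :: "'a::banach \<Rightarrow>\<^sub>L 'a \<Rightarrow>\<^sub>L real" and k :: real
  assumes sym: "b u v = b v u" and k_pos: "0 < k" and coercive: "k * (norm u)\<^sup>2 \<le> b u u"
begin

definition bnorm :: "'a \<Rightarrow> real" where "bnorm u = sqrt (b u u)"

lemma b_nonneg: "0 \<le> b u u"
  using coercive[of u] k_pos by (metis mult_nonneg_nonneg less_imp_le order_trans zero_le_power2)

lemma bnorm_nonneg: "0 \<le> bnorm u" by (simp add: bnorm_def b_nonneg)

lemma bnorm_sq: "(bnorm u)\<^sup>2 = b u u" by (simp add: bnorm_def b_nonneg)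

lemma norm_le_bnorm: "sqrt k * norm u \<le> bnorm u"
  unfolding bnorm_def using real_sqrt_le_mono[OF coercive[of u]] by (simp add: real_sqrt_mult)

lemma bnorm_le_norm: "bnorm u \<le> sqrt (norm b) * norm u"
proof -
  have "b u u \<le> norm (b u) * norm u" using norm_blinfun[of "b u" u] by simp
  also have "\<dots> \<le> norm b * norm u * norm u" by (intro mult_right_mono norm_blinfun) auto
  finally have "b u u \<le> norm b * (norm u)\<^sup>2" by (simp add: power2_eq_square)
  from real_sqrt_le_mono[OF this] show ?thesis by (simp add: bnorm_def real_sqrt_mult)
qed

lemma bnorm_eq_0: "bnorm u = 0 \<longleftrightarrow> u = 0"
  using norm_le_bnorm[of u] k_pos
  by (auto simp: bnorm_def blinfun.zero_right mult_le_0_iff)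

lemma bnorm_minus: "bnorm (- u) = bnorm u"
  by (simp add: bnorm_def blinfun.bilinear_simps)

lemma bnorm_scaleR: "bnorm (a *\<^sub>R u) = \<bar>a\<bar> * bnorm u"
proof -
  have "b (a *\<^sub>R u) (a *\<^sub>R u) = a\<^sup>2 * b u u" by (simp add: blinfun.bilinear_simps power2_eq_square)
  then show ?thesis by (simp add: bnorm_def real_sqrt_mult)
qed

lemma cauchy_schwarz: "b u v \<le> bnorm u * bnorm v"
proof (cases "bnorm u = 0 \<or> bnorm v = 0")
  case True
  then show ?thesis by (auto simp: bnorm_eq_0 blinfun.zero_left blinfun.zero_right bnorm_nonneg)
next
  case False
  define x y where "x = bnorm u" and "y = bnorm v"
  have xy: "x > 0" "y > 0" using False bnorm_nonneg[of u] bnorm_nonneg[of v] by (auto simp: x_def y_def)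
  have "0 \<le> b (y *\<^sub>R u - x *\<^sub>R v) (y *\<^sub>R u - x *\<^sub>R v)" by (rule b_nonneg)
  also have "\<dots> = y\<^sup>2 * b u u - 2 * x * y * b u v + x\<^sup>2 * b v v"
    by (simp add: blinfun.bilinear_simps sym[of v u] power2_eq_square algebra_simps)
  also have "\<dots> = 2 * (x * y) * (x * y - b u v)"
    unfolding bnorm_sq[symmetric] by (simp add: x_def y_def power2_eq_square algebra_simps)
  finally have "0 \<le> 2 * (x * y) * (x * y - b u v)" .
  moreover have "0 < 2 * (x * y)" using xy by simp
  ultimately have "0 \<le> x * y - b u v"
    using zero_le_mult_iff[of "2 * (x * y)" "x * y - b u v"] by linarith
  then show ?thesis by (simp add: x_def y_def)
qed

lemma bnorm_triangle: "bnorm (u + v) \<le> bnorm u + bnorm v"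
proof (rule power2_le_imp_le)
  have "(bnorm (u + v))\<^sup>2 = (bnorm u)\<^sup>2 + 2 * b u v + (bnorm v)\<^sup>2"
    unfolding bnorm_sq by (simp add: blinfun.bilinear_simps sym[of v u])
  also have "\<dots> \<le> (bnorm u + bnorm v)\<^sup>2"
    using cauchy_schwarz[of u v] by (simp add: power2_sum)
  finally show "(bnorm (u + v))\<^sup>2 \<le> (bnorm u + bnorm v)\<^sup>2" .
qed (simp add: bnorm_nonneg)

text \<open>
  Testing the increment \<open>w = f y - f x\<close> against itself reduces the claim to the mean value theorem
  for the real function \<open>b w (f (x + t (y - x)))\<close>, so that the constant \<open>q\<close> is preserved. Passing
  through the norm of the type would lose the factor of the norm equivalence.
\<close>
lemma bnorm_mean_value:
  assumes "convex S" and der: "\<And>p. p \<in> S \<Longrightarrow> (f has_derivative f' p) (at p)"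
    and bound: "\<And>p u. p \<in> S \<Longrightarrow> bnorm (f' p u) \<le> q * bnorm u"
    and x: "x \<in> S" and y: "y \<in> S"
  shows "bnorm (f y - f x) \<le> q * bnorm (y - x)"
proof -
  define w where "w = f y - f x"
  define s where "s t = x + t *\<^sub>R (y - x)" for t
  have s: "s t \<in> S" if "0 \<le> t" "t \<le> 1" for t
  proof -
    have "s t = (1 - t) *\<^sub>R x + t *\<^sub>R y" by (simp add: s_def algebra_simps)
    then show ?thesis using convexD[OF assms(1) x y, of "1 - t" t] that by simp
  qed
  have "((\<lambda>t. b w (f (s t))) has_real_derivative b w (f' (s t) (y - x))) (at t)" if "0 \<le> t" "t \<le> 1" for t
  proof -
    have "(s has_vector_derivative (y - x)) (at t)"
      unfolding s_def by (auto intro!: derivative_eq_intros)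
    from vector_derivative_diff_chain_within[OF this has_derivative_at_withinI[OF der[OF s[OF that]]]]
    have "((\<lambda>t. f (s t)) has_vector_derivative f' (s t) (y - x)) (at t)" by (simp add: o_def)
    from bounded_linear.has_vector_derivative[OF blinfun.bounded_linear_right[of "b w"] this]
    show ?thesis by (simp add: has_real_derivative_iff_has_vector_derivative)
  qed
  then obtain t where t: "0 < t" "t < 1" "b w (f (s 1)) - b w (f (s 0)) = (1 - 0) * b w (f' (s t) (y - x))"
    using MVT2[of 0 1 "\<lambda>t. b w (f (s t))" "\<lambda>t. b w (f' (s t) (y - x))"] by auto
  have "bnorm w * bnorm w = b w (f (s 1)) - b w (f (s 0))"
    using bnorm_sq[of w] by (simp add: s_def w_def blinfun.diff_right power2_eq_square)
  also have "\<dots> = b w (f' (s t) (y - x))" using t by simp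
  also have "\<dots> \<le> bnorm w * bnorm (f' (s t) (y - x))" by (rule cauchy_schwarz)
  also have "\<dots> \<le> bnorm w * (q * bnorm (y - x))"
    using bound[OF s] t by (intro mult_left_mono bnorm_nonneg) auto
  finally have *: "bnorm w * bnorm w \<le> bnorm w * (q * bnorm (y - x))" .
  show ?thesis
  proof (cases "bnorm w = 0")
    case True
    have "0 \<le> q * bnorm (y - x)" using bound[OF x, of "y - x"] bnorm_nonneg order_trans by blast
    then show ?thesis using True by (simp add: w_def)
  next
    case False
    then show ?thesis using * bnorm_nonneg[of w] by (simp add: w_def mult_le_cancel_left)
  qed
qed

text \<open>
  Banach's theorem on a closed ball of the second norm, which is complete because the two norms are
  equivalent.
\<close>
lemma bnorm_contraction_fixed_point:
  assumes "0 \<le> \<rho>" and "0 \<le> q" "q < 1"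
    and contr: "\<And>x y. bnorm (x - p) \<le> \<rho> \<Longrightarrow> bnorm (y - p) \<le> \<rho> \<Longrightarrow> bnorm (f y - f x) \<le> q * bnorm (y - x)"
    and start: "bnorm (f p - p) \<le> (1 - q) * \<rho>"
  shows "\<exists>x. bnorm (x - p) \<le> \<rho> \<and> f x = x"
proof -
  define S where "S = {x. bnorm (x - p) \<le> \<rho>}"
  interpret Metric_space S "\<lambda>x y. bnorm (x - y)"
  proof
    show "0 \<le> bnorm (x - y)" for x y by (rule bnorm_nonneg)
    show "bnorm (x - y) = bnorm (y - x)" for x y using bnorm_minus[of "x - y"] by simp
    show "bnorm (x - y) = 0 \<longleftrightarrow> x = y" for x y by (simp add: bnorm_eq_0)
    show "bnorm (x - z) \<le> bnorm (x - y) + bnorm (y - z)" for x y z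
      using bnorm_triangle[of "x - y" "y - z"] by simp
  qed
  have p: "p \<in> S" using assms(1) bnorm_eq_0[of 0] by (simp add: S_def)
  have complete: mcomplete
    unfolding mcomplete_def
  proof (intro allI impI)
    fix X assume X: "MCauchy X"
    have sk: "0 < sqrt k" using k_pos by simp
    have "Cauchy X"
      unfolding Cauchy_def
    proof (intro allI impI)
      fix e :: real assume "0 < e"
      then have "0 < sqrt k * e" using sk by simp
      then obtain N where N: "\<And>i j. N \<le> i \<Longrightarrow> N \<le> j \<Longrightarrow> bnorm (X i - X j) < sqrt k * e"
        using X unfolding MCauchy_def by meson
      have "dist (X i) (X j) < e" if "N \<le> i" "N \<le> j" for i j
        using le_less_trans[OF norm_le_bnorm N[OF that]] sk by (simp add: dist_norm)
      then show "\<exists>N. \<forall>i\<ge>N. \<forall>j\<ge>N. dist (X i) (X j) < e" by blast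
    qed
    then obtain l where l: "X \<longlonglongrightarrow> l" using Cauchy_convergent convergent_def by blast
    have lim: "(\<lambda>n. bnorm (X n - a)) \<longlonglongrightarrow> bnorm (l - a)" for a
      unfolding bnorm_def by (intro tendsto_intros l)
    have range: "range X \<subseteq> S" using X by (simp add: MCauchy_def)
    have "bnorm (l - p) \<le> \<rho>"
      by (rule LIMSEQ_le_const2[OF lim[of p]]) (use range in \<open>auto simp: S_def\<close>)
    moreover have "(\<lambda>n. bnorm (X n - l)) \<longlonglongrightarrow> 0" using lim[of l] bnorm_eq_0[of 0] by simp
    ultimately have "limitin mtopology X l sequentially"
      unfolding limitin_metric_dist_null using range
      by (auto simp: S_def image_subset_iff intro!: always_eventually)
    then show "\<exists>x. limitin mtopology X x sequentially" by blast
  qed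
  have self: "f x \<in> S" if x: "x \<in> S" for x
  proof -
    have "bnorm (f x - p) \<le> bnorm (f x - f p) + bnorm (f p - p)"
      using bnorm_triangle[of "f x - f p" "f p - p"] by simp
    also have "\<dots> \<le> q * bnorm (x - p) + (1 - q) * \<rho>"
      using contr[of p x] x p start by (intro add_mono) (auto simp: S_def)
    also have "\<dots> \<le> q * \<rho> + (1 - q) * \<rho>"
      using x assms(2) by (intro add_right_mono mult_left_mono) (auto simp: S_def)
    finally show ?thesis by (simp add: S_def algebra_simps)
  qed
  obtain x where "x \<in> S" "f x = x"
  proof (rule Banach_fixedpoint_thm[OF complete _ _ \<open>q < 1\<close>])
    show "S \<noteq> {}" using p by blast
    show "f \<in> S \<rightarrow> S" using self by blast
    show "bnorm (f x - f y) \<le> q * bnorm (x - y)" if "x \<in> S" "y \<in> S" for x y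
      using contr[of y x] that by (simp add: S_def)
  qed
  then show ?thesis by (auto simp: S_def)
qed

text \<open>
  The relaxed map \<open>\<Phi> x = x - s (x - F x)\<close> is a contraction near \<open>p\<close>. The admissible distance \<open>\<epsilon>\<close> of
  the derivatives from \<open>T\<close> does not depend on the radius \<open>\<rho>\<close>; only the displacement \<open>\<eta>\<close> of the centre
  has to be small compared with \<open>\<rho>\<close>. This order of quantifiers lets \<open>\<rho>\<close> be taken so small that \<open>T\<close> is
  approximated within \<open>\<epsilon>\<close>.
\<close>
lemma fixed_point_if_derivative_near:
  assumes T: "bounded_linear T" and K: "\<And>u. b u (T u) \<le> K * b u u" "K < 1"
  shows "\<exists>\<epsilon>>0. \<forall>\<rho>>0. \<exists>\<eta>>0. \<forall>F F' p.
    (\<forall>x\<in>cball p \<rho>. (F has_derivative F' x) (at x) \<and> (\<forall>u. norm (F' x u - T u) \<le> \<epsilon> * norm u))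
    \<and> norm (F p - p) \<le> \<eta> \<longrightarrow> (\<exists>x\<in>cball p \<rho>. F x = x)"
proof -
  define S where "S u = u - T u" for u
  have "bounded_linear S" unfolding S_def by (intro bounded_linear_sub bounded_linear_ident T)
  then obtain c where c: "c > 0" "\<And>u. norm (S u) \<le> norm u * c" using bounded_linear.pos_bounded by blast
  \<comment> \<open>Upper constant of the norm equivalence, made positive so that it may be divided by.\<close>
  define b1 where "b1 = norm b + 1"
  have b1: "b1 > 0" "bnorm u \<le> sqrt b1 * norm u" for u
  proof -
    show "b1 > 0" by (simp add: b1_def add_nonneg_pos)
    have "sqrt (norm b) * norm u \<le> sqrt b1 * norm u"
      by (intro mult_right_mono) (auto simp: b1_def)
    then show "bnorm u \<le> sqrt b1 * norm u" using bnorm_le_norm[of u] by linarith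
  qed
  define \<alpha> where "\<alpha> = 1 - K"
  \<comment> \<open>The first summand bounds \<open>b (S u) (S u) / b u u\<close>; the others ensure \<open>\<alpha>\<^sup>2 < \<Lambda>\<close>.\<close>
  define \<Lambda> where "\<Lambda> = b1 * c\<^sup>2 / k + \<alpha>\<^sup>2 + 1"
  have \<alpha>: "\<alpha> > 0" using K by (simp add: \<alpha>_def)
  have "0 \<le> b1 * c\<^sup>2 / k" using b1 c k_pos by simp
  then have \<Lambda>: "\<Lambda> \<ge> b1 * c\<^sup>2 / k" "\<Lambda> > \<alpha>\<^sup>2" "\<Lambda> > 0" by (auto simp: \<Lambda>_def add_nonneg_pos)
  \<comment> \<open>This minimizes \<open>1 - 2 \<alpha> s + \<Lambda> s\<^sup>2\<close>, with minimum \<open>1 - \<alpha>\<^sup>2 / \<Lambda> = q\<^sup>2\<close>.\<close>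
  define s where "s = \<alpha> / \<Lambda>"
  have s: "s > 0" using \<alpha> \<Lambda> by (simp add: s_def)
  define q where "q = sqrt (1 - \<alpha>\<^sup>2 / \<Lambda>)"
  have "\<alpha>\<^sup>2 / \<Lambda> < 1" "\<alpha>\<^sup>2 / \<Lambda> > 0" using \<alpha> \<Lambda> by auto
  then have q: "0 \<le> q" "q < 1" "q\<^sup>2 = 1 - \<alpha>\<^sup>2 / \<Lambda>" by (auto simp: q_def)
  have lin: "bnorm (u - s *\<^sub>R S u) \<le> q * bnorm u" for u
  proof (rule power2_le_imp_le)
    have bs: "\<alpha> * b u u \<le> b u (S u)"
      using K(1)[of u] by (simp add: S_def \<alpha>_def blinfun.bilinear_simps algebra_simps)
    have "bnorm (S u) \<le> sqrt b1 * (c * norm u)"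
      using b1 c(2)[of u] by (metis mult.commute mult_left_mono order_trans real_sqrt_ge_zero less_imp_le)
    then have "(bnorm (S u))\<^sup>2 \<le> (sqrt b1 * (c * norm u))\<^sup>2" by (intro power_mono bnorm_nonneg)
    also have "\<dots> = b1 * c\<^sup>2 / k * (k * (norm u)\<^sup>2)"
      using b1 k_pos by (simp add: power_mult_distrib)
    also have "\<dots> \<le> \<Lambda> * b u u"
      using \<Lambda> coercive k_pos by (intro mult_mono) auto
    finally have SS: "b (S u) (S u) \<le> \<Lambda> * b u u" by (simp add: bnorm_sq)
    have "(bnorm (u - s *\<^sub>R S u))\<^sup>2 = b u u - 2 * s * b u (S u) + s\<^sup>2 * b (S u) (S u)"
      unfolding bnorm_sq
      by (simp add: blinfun.bilinear_simps sym[of "S u" u] power2_eq_square algebra_simps)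
    also have "\<dots> \<le> b u u - 2 * s * (\<alpha> * b u u) + s\<^sup>2 * (\<Lambda> * b u u)"
      using bs SS s by (intro add_mono diff_mono mult_left_mono) auto
    also have "\<dots> = (1 - \<alpha>\<^sup>2 / \<Lambda>) * b u u"
      using \<Lambda>(3) by (simp add: s_def power2_eq_square field_simps)
    also have "\<dots> = (q * bnorm u)\<^sup>2" by (simp add: power_mult_distrib q(3) bnorm_sq)
    finally show "(bnorm (u - s *\<^sub>R S u))\<^sup>2 \<le> (q * bnorm u)\<^sup>2" .
  qed (simp add: q(1) bnorm_nonneg)
  \<comment> \<open>The deviation of the derivative from \<open>T\<close> may use up half of the gap between \<open>q\<close> and \<open>1\<close>.\<close>
  define \<epsilon> where "\<epsilon> = (1 - q) / 2 * sqrt k / (s * sqrt b1)"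
  define q' where "q' = (1 + q) / 2"
  have \<epsilon>: "\<epsilon> > 0" using q s b1 k_pos by (simp add: \<epsilon>_def)
  have q': "0 \<le> q'" "q' < 1" using q by (auto simp: q'_def)
  show ?thesis
  proof (rule exI[of _ \<epsilon>], intro conjI allI impI \<epsilon>)
    fix \<rho> :: real assume \<rho>: "0 < \<rho>"
    \<comment> \<open>Measured by \<open>b\<close>, a ball of radius \<open>sqrt k * \<rho>\<close> lies inside the given ball; it is mapped to itself.\<close>
    define \<eta> where "\<eta> = (1 - q') * (sqrt k * \<rho>) / (s * sqrt b1)"
    have \<eta>: "\<eta> > 0" using q' s b1 k_pos \<rho> by (simp add: \<eta>_def)
    show "\<exists>\<eta>>0. \<forall>F F' p.
      (\<forall>x\<in>cball p \<rho>. (F has_derivative F' x) (at x) \<and> (\<forall>u. norm (F' x u - T u) \<le> \<epsilon> * norm u))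
      \<and> norm (F p - p) \<le> \<eta> \<longrightarrow> (\<exists>x\<in>cball p \<rho>. F x = x)"
    proof (rule exI[of _ \<eta>], intro conjI allI impI \<eta>)
      fix F F' and p
      assume *: "(\<forall>x\<in>cball p \<rho>. (F has_derivative F' x) (at x) \<and> (\<forall>u. norm (F' x u - T u) \<le> \<epsilon> * norm u))
        \<and> norm (F p - p) \<le> \<eta>"
      define \<Phi> where "\<Phi> x = x - s *\<^sub>R (x - F x)" for x
      have inb: "x \<in> cball p \<rho>" if "bnorm (x - p) \<le> sqrt k * \<rho>" for x
        using order_trans[OF norm_le_bnorm that] k_pos by (simp add: dist_norm norm_minus_commute)
      have der: "(\<Phi> has_derivative (\<lambda>u. u - s *\<^sub>R (u - F' x u))) (at x)" if "x \<in> cball p \<rho>" for x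
        unfolding \<Phi>_def using * that by (auto intro!: derivative_eq_intros)
      have bound: "bnorm (u - s *\<^sub>R (u - F' x u)) \<le> q' * bnorm u" if "x \<in> cball p \<rho>" for x u
      proof -
        have "bnorm (u - s *\<^sub>R (u - F' x u)) = bnorm ((u - s *\<^sub>R S u) + s *\<^sub>R (F' x u - T u))"
          by (simp add: S_def algebra_simps)
        also have "\<dots> \<le> bnorm (u - s *\<^sub>R S u) + s * bnorm (F' x u - T u)"
          using bnorm_triangle[of "u - s *\<^sub>R S u" "s *\<^sub>R (F' x u - T u)"] s by (simp add: bnorm_scaleR)
        also have "bnorm (F' x u - T u) \<le> sqrt b1 * (\<epsilon> * norm u)"
          using b1 * that by (meson mult_left_mono order_trans real_sqrt_ge_zero less_imp_le)
        also have "sqrt b1 * (\<epsilon> * norm u) = (1 - q) / 2 / s * (sqrt k * norm u)"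
          using b1 s by (simp add: \<epsilon>_def)
        also have "\<dots> \<le> (1 - q) / 2 / s * bnorm u"
          using q s norm_le_bnorm by (intro mult_left_mono) auto
        finally have "bnorm (u - s *\<^sub>R (u - F' x u)) \<le> q * bnorm u + s * ((1 - q) / 2 / s * bnorm u)"
          using lin[of u] s by simp
        also have "\<dots> = q' * bnorm u" using s by (simp add: q'_def field_simps)
        finally show ?thesis .
      qed
      have "bnorm (\<Phi> p - p) = s * bnorm (F p - p)"
        using s bnorm_scaleR[of s "F p - p"] by (simp add: \<Phi>_def algebra_simps)
      also have "\<dots> \<le> s * (sqrt b1 * \<eta>)"
        using s b1 * by (meson mult_left_mono order_trans real_sqrt_ge_zero less_imp_le)
      also have "\<dots> = (1 - q') * (sqrt k * \<rho>)" using s b1 by (simp add: \<eta>_def)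
      finally have start: "bnorm (\<Phi> p - p) \<le> (1 - q') * (sqrt k * \<rho>)" .
      have "0 \<le> sqrt k * \<rho>" using k_pos \<rho> by simp
      moreover have "bnorm (\<Phi> y - \<Phi> x) \<le> q' * bnorm (y - x)"
        if "bnorm (x - p) \<le> sqrt k * \<rho>" "bnorm (y - p) \<le> sqrt k * \<rho>" for x y
        using bnorm_mean_value[OF convex_cball der bound inb[OF that(1)] inb[OF that(2)]] .
      ultimately obtain x where x: "bnorm (x - p) \<le> sqrt k * \<rho>" "\<Phi> x = x"
        using bnorm_contraction_fixed_point[where f = \<Phi> and q = q' and \<rho> = "sqrt k * \<rho>" and p = p] q' start by blast
      then have "F x = x" using s by (simp add: \<Phi>_def)
      then show "\<exists>x\<in>cball p \<rho>. F x = x" using inb[OF x(1)] by blast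
    qed
  qed
qed

end

section \<open>Charts and tangent vectors\<close>

locale smooth_manifold =
  fixes A :: "('m::t2_space, 'h::{real_inner,banach}) chart set"
  assumes atlas: "smooth_atlas A"
begin

abbreviation jac :: "('m, 'h) chart \<Rightarrow> ('m, 'h) chart \<Rightarrow> 'm \<Rightarrow> 'h \<Rightarrow> 'h" where
  "jac c d x \<equiv> frechet_derivative (snd d \<circ> chart_inv c) (at (snd c x))"

lemma chart_homeomorphism:
  "c \<in> A \<Longrightarrow> homeomorphism (fst c) (snd c ` fst c) (snd c) (chart_inv c)"
  using atlas unfolding smooth_atlas_def by blast

lemma open_chart_domain: "c \<in> A \<Longrightarrow> open (fst c)"
  using atlas unfolding smooth_atlas_def by blast

lemma open_chart_range: "c \<in> A \<Longrightarrow> open (snd c ` fst c)"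
  using atlas unfolding smooth_atlas_def by blast

lemma chart_inv_chart: "c \<in> A \<Longrightarrow> x \<in> fst c \<Longrightarrow> chart_inv c (snd c x) = x"
  using chart_homeomorphism unfolding homeomorphism_def by blast

lemma chart_chart_inv: "c \<in> A \<Longrightarrow> p \<in> snd c ` fst c \<Longrightarrow> snd c (chart_inv c p) = p"
  using chart_homeomorphism unfolding homeomorphism_def by blast

lemma chart_inv_in_domain: "c \<in> A \<Longrightarrow> p \<in> snd c ` fst c \<Longrightarrow> chart_inv c p \<in> fst c"
  using chart_inv_chart by fastforce

lemma continuous_on_chart: "c \<in> A \<Longrightarrow> continuous_on (fst c) (snd c)"
  using chart_homeomorphism unfolding homeomorphism_def by blast

lemma continuous_on_chart_inv: "c \<in> A \<Longrightarrow> continuous_on (snd c ` fst c) (chart_inv c)"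
  using chart_homeomorphism unfolding homeomorphism_def by blast

lemma open_chart_image:
  assumes "c \<in> A" and "open T"
  shows "open (snd c ` (fst c \<inter> T))"
proof -
  have "openin (top_of_set (fst c)) (fst c \<inter> T)"
    using assms(2) by (simp add: openin_open_Int)
  from homeomorphism_imp_open_map[OF chart_homeomorphism[OF assms(1)] this]
  show ?thesis using open_chart_range[OF assms(1)] openin_open_trans by blast
qed

lemma charts_atD: "c \<in> charts_at A x \<Longrightarrow> c \<in> A" "c \<in> charts_at A x \<Longrightarrow> x \<in> fst c"
  by (auto simp: charts_at_def)

lemma charts_at_nonempty: "\<exists>c. c \<in> charts_at A x"
  using atlas unfolding smooth_atlas_def charts_at_def by blast

lemma transition_smooth:
  "c \<in> A \<Longrightarrow> d \<in> A \<Longrightarrow> smooth_on (snd c ` (fst c \<inter> fst d)) (snd d \<circ> chart_inv c)"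
  using atlas unfolding smooth_atlas_def by blast

lemma transition_has_derivative:
  assumes "c \<in> charts_at A x" and "d \<in> charts_at A x"
  shows "((snd d \<circ> chart_inv c) has_derivative jac c d x) (at (snd c x))"
proof -
  note c = charts_atD[OF assms(1)] and d = charts_atD[OF assms(2)]
  obtain D where "\<And>p. p \<in> snd c ` (fst c \<inter> fst d) \<Longrightarrow>
      ((snd d \<circ> chart_inv c) has_derivative blinfun_apply (D p)) (at p)"
    using smooth_on_imp_C1[OF transition_smooth[OF c(1) d(1)] open_chart_image[OF c(1) open_chart_domain[OF d(1)]]]
    by blast
  then have "((snd d \<circ> chart_inv c) has_derivative blinfun_apply (D (snd c x))) (at (snd c x))"
    using c d by blast
  then show ?thesis
    using differentiableI frechet_derivative_works by blast
qed

lemma linear_jac: "c \<in> charts_at A x \<Longrightarrow> d \<in> charts_at A x \<Longrightarrow> bounded_linear (jac c d x)"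
  using transition_has_derivative has_derivative_bounded_linear by blast

lemma jac_refl:
  assumes "c \<in> charts_at A x"
  shows "jac c c x u = u"
proof -
  note c = charts_atD[OF assms]
  have "((\<lambda>p. p) has_derivative jac c c x) (at (snd c x))"
    by (rule has_derivative_transform_within_open[OF transition_has_derivative[OF assms assms]
          open_chart_range[OF c(1)]]) (use c chart_chart_inv[OF c(1)] in \<open>simp_all\<close>)
  from fun_cong[OF has_derivative_unique[OF this has_derivative_ident], of u] show ?thesis .
qed

lemma jac_trans:
  assumes "c \<in> charts_at A x" "d \<in> charts_at A x" "e \<in> charts_at A x"
  shows "jac d e x (jac c d x u) = jac c e x u"
proof -
  note c = charts_atD[OF assms(1)] and d = charts_atD[OF assms(2)] and e = charts_atD[OF assms(3)]
  have eq: "(snd d \<circ> chart_inv c) (snd c x) = snd d x"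
    using chart_inv_chart[OF c] by simp
  have "((snd e \<circ> chart_inv d) \<circ> (snd d \<circ> chart_inv c) has_derivative jac d e x \<circ> jac c d x) (at (snd c x))"
    by (rule diff_chain_at[OF transition_has_derivative[OF assms(1,2)]])
      (unfold eq, rule transition_has_derivative[OF assms(2,3)])
  then have "((snd e \<circ> chart_inv c) has_derivative jac d e x \<circ> jac c d x) (at (snd c x))"
    by (rule has_derivative_transform_within_open[OF _ open_chart_image[OF c(1) open_chart_domain[OF d(1)]]])
      (use c(2) d(2) chart_inv_chart[OF c(1)] chart_inv_chart[OF d(1)] in auto)
  from fun_cong[OF has_derivative_unique[OF this transition_has_derivative[OF assms(1,3)]], of u]
  show ?thesis by simp
qed

lemma tangent_spaceI:
  assumes "\<And>c d. c \<in> charts_at A x \<Longrightarrow> d \<in> charts_at A x \<Longrightarrow> v d = jac c d x (v c)"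
    and "\<And>c. c \<notin> charts_at A x \<Longrightarrow> v c = 0"
  shows "v \<in> tangent_space A x"
  using assms unfolding tangent_space_def by blast

lemma tangent_space_chart_change:
  "v \<in> tangent_space A x \<Longrightarrow> c \<in> charts_at A x \<Longrightarrow> d \<in> charts_at A x \<Longrightarrow> v d = jac c d x (v c)"
  unfolding tangent_space_def by blast

lemma tangent_space_outside: "v \<in> tangent_space A x \<Longrightarrow> c \<notin> charts_at A x \<Longrightarrow> v c = 0"
  unfolding tangent_space_def by blast

lemma tvector_of_in_tangent_space:
  "c \<in> charts_at A x \<Longrightarrow> tvector_of A c x u \<in> tangent_space A x"
  by (simp add: tangent_space_def tvector_of_def jac_trans)

lemma tvector_of_coord: "c \<in> charts_at A x \<Longrightarrow> tvector_of A c x u c = u"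
  by (simp add: tvector_of_def jac_refl)

lemma tangent_space_diff:
  assumes "v \<in> tangent_space A x" "w \<in> tangent_space A x"
  shows "(\<lambda>c. v c - w c) \<in> tangent_space A x"
proof -
  have "v d - w d = jac c d x (v c - w c)" if "c \<in> charts_at A x" "d \<in> charts_at A x" for c d
    using linear_diff[OF bounded_linear.linear[OF linear_jac[OF that]]]
      tangent_space_chart_change[OF assms(1) that] tangent_space_chart_change[OF assms(2) that] by simp
  then show ?thesis
    by (rule tangent_spaceI) (simp_all add: tangent_space_outside[OF assms(1)] tangent_space_outside[OF assms(2)])
qed

text \<open>
  This is stated relative to a set because curves live on \<open>{0..1}\<close> and have only one-sided derivatives
  at its ends.
\<close>
lemma chart_change_has_vector_derivative:
  assumes c: "c \<in> charts_at A (\<gamma> t)" and d: "d \<in> charts_at A (\<gamma> t)"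
    and cont: "continuous (at t within S) \<gamma>" and t: "t \<in> S"
    and der: "((snd c \<circ> \<gamma>) has_vector_derivative v) (at t within S)"
  shows "((snd d \<circ> \<gamma>) has_vector_derivative jac c d (\<gamma> t) v) (at t within S)"
proof -
  note cA = charts_atD[OF c] and dA = charts_atD[OF d]
  have "((snd d \<circ> chart_inv c) has_derivative jac c d (\<gamma> t)) (at ((snd c \<circ> \<gamma>) t))"
    using transition_has_derivative[OF c d] by simp
  from vector_derivative_diff_chain_within[OF der has_derivative_at_withinI[OF this]]
  have "((snd d \<circ> chart_inv c) \<circ> (snd c \<circ> \<gamma>) has_vector_derivative jac c d (\<gamma> t) v) (at t within S)" .
  moreover have "\<forall>\<^sub>F s in at t within S. \<gamma> s \<in> fst c"
    using cont topological_tendstoD[OF _ open_chart_domain[OF cA(1)] cA(2)]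
    unfolding continuous_within by blast
  then have "\<forall>\<^sub>F s in at t within S. ((snd d \<circ> chart_inv c) \<circ> (snd c \<circ> \<gamma>)) s = (snd d \<circ> \<gamma>) s"
    by eventually_elim (use chart_inv_chart[OF cA(1)] in auto)
  ultimately show ?thesis
    unfolding has_vector_derivative_def
    by (rule has_derivative_transform_eventually) (use chart_inv_chart[OF cA] t in auto)
qed

lemma velocity_in_tangent_space:
  assumes "C1_curve_on A 0 1 \<gamma>" and t: "t \<in> {0..1}"
  shows "velocity A \<gamma> t \<in> tangent_space A (\<gamma> t)"
proof -
  have "velocity A \<gamma> t d = jac c d (\<gamma> t) (velocity A \<gamma> t c)"
    if c: "c \<in> charts_at A (\<gamma> t)" and d: "d \<in> charts_at A (\<gamma> t)" for c d
  proof -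
    have cont: "continuous (at t within {0..1}) \<gamma>"
      using assms unfolding C1_curve_on_def by (simp add: continuous_on_eq_continuous_within)
    obtain v where v: "((snd c \<circ> \<gamma>) has_vector_derivative v) (at t within {0..1})"
      using assms charts_atD[OF c] unfolding C1_curve_on_def by blast
    note w = chart_change_has_vector_derivative[OF c d cont t v]
    show ?thesis
      using vector_derivative_within_cbox[of 0 1 t, unfolded cbox_interval, OF zero_less_one t v]
        vector_derivative_within_cbox[of 0 1 t, unfolded cbox_interval, OF zero_less_one t w] c d
      by (simp add: velocity_def)
  qed
  then show ?thesis by (rule tangent_spaceI) (simp_all add: velocity_def)
qed

lemma map_rep_has_derivative:
  assumes "differentiable_map A F" "c \<in> charts_at A x" "d \<in> charts_at A (F x)"
  shows "(map_rep F c d has_derivative frechet_derivative (map_rep F c d) (at (snd c x))) (at (snd c x))"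
  using assms frechet_derivative_works unfolding differentiable_map_def by blast

lemma open_map_domain:
  assumes "differentiable_map A F" "c \<in> A" "d \<in> A"
  shows "open (snd c ` (fst c \<inter> F -` fst d))"
  by (intro open_chart_image[OF assms(2)] open_vimage open_chart_domain[OF assms(3)])
    (use assms(1) in \<open>auto simp: differentiable_map_def\<close>)

text \<open>
  The differential is defined with a chart that is chosen once and for all at each point; the chain
  rule allows any chart.
\<close>
lemma differential_coord:
  assumes F: "differentiable_map A F" and c: "c \<in> charts_at A x" and d: "d \<in> charts_at A (F x)"
    and v: "v \<in> tangent_space A x"
  shows "differential A F x v d = frechet_derivative (map_rep F c d) (at (snd c x)) (v c)"
proof -
  define c' where "c' = (SOME c. c \<in> charts_at A x)"
  have c': "c' \<in> charts_at A x" unfolding c'_def using charts_at_nonempty by (rule someI_ex)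
  note cA = charts_atD[OF c] and dA = charts_atD[OF d] and c'A = charts_atD[OF c']
  have eq: "(snd c' \<circ> chart_inv c) (snd c x) = snd c' x"
    using chart_inv_chart[OF cA] by simp
  have "(map_rep F c' d \<circ> (snd c' \<circ> chart_inv c) has_derivative
      frechet_derivative (map_rep F c' d) (at (snd c' x)) \<circ> jac c c' x) (at (snd c x))"
    by (rule diff_chain_at[OF transition_has_derivative[OF c c']])
      (unfold eq, rule map_rep_has_derivative[OF F c' d])
  then have "(map_rep F c d has_derivative
      frechet_derivative (map_rep F c' d) (at (snd c' x)) \<circ> jac c c' x) (at (snd c x))"
    by (rule has_derivative_transform_within_open[OF _ open_chart_image[OF cA(1) open_chart_domain[OF c'A(1)]]])
      (use cA(2) c'A(2) chart_inv_chart[OF cA(1)] chart_inv_chart[OF c'A(1)] in \<open>auto simp: map_rep_def\<close>)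
  from fun_cong[OF has_derivative_unique[OF this map_rep_has_derivative[OF F c d]], of "v c"]
  have "frechet_derivative (map_rep F c' d) (at (snd c' x)) (jac c c' x (v c))
      = frechet_derivative (map_rep F c d) (at (snd c x)) (v c)"
    by simp
  then show ?thesis
    using d tangent_space_chart_change[OF v c c'] by (simp add: differential_def Let_def c'_def[symmetric])
qed

lemma differential_in_tangent_space:
  assumes F: "differentiable_map A F" and v: "v \<in> tangent_space A x"
  shows "differential A F x v \<in> tangent_space A (F x)"
proof -
  obtain c where c: "c \<in> charts_at A x" using charts_at_nonempty by blast
  note cA = charts_atD[OF c]
  have "differential A F x v e = jac d e (F x) (differential A F x v d)"
    if d: "d \<in> charts_at A (F x)" and e: "e \<in> charts_at A (F x)" for d e
  proof -
    note dA = charts_atD[OF d] and eA = charts_atD[OF e]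
    have eq: "map_rep F c d (snd c x) = snd d (F x)"
      using chart_inv_chart[OF cA] by (simp add: map_rep_def)
    have "((snd e \<circ> chart_inv d) \<circ> map_rep F c d has_derivative
        jac d e (F x) \<circ> frechet_derivative (map_rep F c d) (at (snd c x))) (at (snd c x))"
      by (rule diff_chain_at[OF map_rep_has_derivative[OF F c d]])
        (unfold eq, rule transition_has_derivative[OF d e])
    then have "(map_rep F c e has_derivative
        jac d e (F x) \<circ> frechet_derivative (map_rep F c d) (at (snd c x))) (at (snd c x))"
      by (rule has_derivative_transform_within_open[OF _ open_map_domain[OF F cA(1) dA(1)]])
        (use cA(2) dA(2) chart_inv_chart[OF cA(1)] chart_inv_chart[OF dA(1)] in \<open>auto simp: map_rep_def\<close>)
    from fun_cong[OF has_derivative_unique[OF this map_rep_has_derivative[OF F c e]], of "v c"]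
    show ?thesis
      using differential_coord[OF F c d v] differential_coord[OF F c e v] by simp
  qed
  then show ?thesis by (rule tangent_spaceI) (simp_all add: differential_def Let_def)
qed

lemma C1_map_imp_differentiable_map:
  assumes "C1_map A F"
  shows "differentiable_map A F"
  unfolding differentiable_map_def
proof (intro conjI allI ballI)
  show "continuous_on UNIV F" using assms by (simp add: C1_map_def)
  fix x c d assume "c \<in> charts_at A x" "d \<in> charts_at A (F x)"
  then have "c \<in> A" "d \<in> A" "snd c x \<in> snd c ` (fst c \<inter> F -` fst d)"
    by (auto simp: charts_at_def)
  then show "map_rep F c d differentiable at (snd c x)"
    using assms unfolding C1_map_def differentiable_def by blast
qed

end

section \<open>The metric in a chart\<close>

locale riemannian =
  fixes A :: "('m::t2_space, 'h::{real_inner,banach}) chart set" and g :: "('m, 'h) metric"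
  assumes riem: "riemannian_manifold A g"

sublocale riemannian \<subseteq> smooth_manifold A
  using riem by unfold_locales (simp add: riemannian_manifold_def)

context riemannian
begin

text \<open>
  The Gram operator of the metric in a chart with its derivative, which enters the Christoffel symbols
  and is locally bounded because it is continuous.
\<close>
lemma metric_in_chart:
  assumes c: "c \<in> A"
  obtains B :: "'h \<Rightarrow> 'h \<Rightarrow>\<^sub>L 'h \<Rightarrow>\<^sub>L real" and B'
  where "\<And>x v w. x \<in> fst c \<Longrightarrow> v \<in> tangent_space A x \<Longrightarrow> w \<in> tangent_space A x
           \<Longrightarrow> g x v w = B (snd c x) (v c) (w c)"
    and "\<And>p. p \<in> snd c ` fst c \<Longrightarrow> (B has_derivative blinfun_apply (B' p)) (at p)"
    and "continuous_on (snd c ` fst c) B'"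
    and "\<And>p u v. p \<in> snd c ` fst c \<Longrightarrow> B p u v = B p v u"
    and "\<And>p. p \<in> snd c ` fst c \<Longrightarrow> \<exists>k>0. \<forall>u. k * (norm u)\<^sup>2 \<le> B p u u"
proof -
  obtain B :: "'h \<Rightarrow> 'h \<Rightarrow>\<^sub>L 'h \<Rightarrow>\<^sub>L real" where
    smooth: "smooth_on (snd c ` fst c) B" and
    eq: "\<forall>x\<in>fst c. \<forall>v\<in>tangent_space A x. \<forall>w\<in>tangent_space A x. g x v w = B (snd c x) (v c) (w c)" and
    sp: "\<forall>p \<in> snd c ` fst c. (\<forall>u v. B p u v = B p v u) \<and> (\<exists>k>0. \<forall>u. k * (norm u)\<^sup>2 \<le> B p u u)"
    using riem c unfolding riemannian_manifold_def by blast
  obtain B' where B': "continuous_on (snd c ` fst c) B'"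
      "\<And>p. p \<in> snd c ` fst c \<Longrightarrow> (B has_derivative blinfun_apply (B' p)) (at p)"
    by (rule smooth_on_imp_C1[OF smooth open_chart_range[OF c]]) blast
  show thesis
    by (rule that[of B B']) (use eq sp B' in blast)+
qed

text \<open>
  The length is a Henstock--Kurzweil integral, which has the value \<open>0\<close> for a function that is not
  integrable. Continuity of the speed is what makes the length control the curve.
\<close>
lemma continuous_on_speed:
  assumes "C1_curve_on A 0 1 \<gamma>"
  shows "continuous_on {0..1} (\<lambda>t. rnorm g (\<gamma> t) (velocity A \<gamma> t))"
  unfolding continuous_on_eq_continuous_within
proof
  fix t :: real assume t: "t \<in> {0..1}"
  obtain c where c: "c \<in> charts_at A (\<gamma> t)" using charts_at_nonempty by blast
  note cA = charts_atD[OF c]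
  obtain B B' where B: "\<And>x v w. x \<in> fst c \<Longrightarrow> v \<in> tangent_space A x \<Longrightarrow> w \<in> tangent_space A x
           \<Longrightarrow> g x v w = blinfun_apply (blinfun_apply (B (snd c x)) (v c)) (w c)"
    and B': "\<And>p. p \<in> snd c ` fst c \<Longrightarrow> (B has_derivative blinfun_apply (B' p)) (at p)"
    by (rule metric_in_chart[OF cA(1)]) blast
  let ?N = "{0..1} \<inter> \<gamma> -` fst c"
  have cont: "continuous_on {0..1} \<gamma>"
    using assms by (simp add: C1_curve_on_def)
  obtain D where D: "continuous_on ?N D" and
    dD: "\<And>s. s \<in> ?N \<Longrightarrow> ((snd c \<circ> \<gamma>) has_vector_derivative D s) (at s within {0..1})"
    using assms cA(1) unfolding C1_curve_on_def by blast
  have vel: "velocity A \<gamma> s c = D s" if "s \<in> ?N" for s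
    using that vector_derivative_within_cbox[of 0 1 s, unfolded cbox_interval, OF zero_less_one _ dD[OF that]] cA
    by (simp add: velocity_def charts_at_def)
  have "continuous_on (snd c ` fst c) B"
    using has_derivative_continuous[OF B'] continuous_at_imp_continuous_on by blast
  moreover have "continuous_on ?N (\<lambda>s. snd c (\<gamma> s))"
    by (rule continuous_on_compose2[OF continuous_on_chart[OF cA(1)] continuous_on_subset[OF cont]]) auto
  ultimately have "continuous_on ?N (\<lambda>s. B (snd c (\<gamma> s)))"
    by (rule continuous_on_compose2) auto
  then have "continuous_on ?N (\<lambda>s. sqrt (B (snd c (\<gamma> s)) (D s) (D s)))"
    by (intro continuous_intros D)
  then have "continuous_on ?N (\<lambda>s. rnorm g (\<gamma> s) (velocity A \<gamma> s))"
    by (rule continuous_on_eq)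
      (use B velocity_in_tangent_space[OF assms] vel in \<open>auto simp: rnorm_def\<close>)
  then have "continuous (at t within ?N) (\<lambda>s. rnorm g (\<gamma> s) (velocity A \<gamma> s))"
    using t cA by (simp add: continuous_on_eq_continuous_within)
  moreover obtain T where T: "open T" "?N = {0..1} \<inter> T"
    using cont open_chart_domain[OF cA(1)] unfolding continuous_on_open_invariant
    by (metis Int_commute)
  have "at t within ?N = at t within {0..1}"
  proof (rule at_within_nhd[of _ T])
    show "t \<in> T" using T(2) t cA(2) by blast
    show "?N \<inter> T - {t} = {0..1} \<inter> T - {t}" unfolding T(2) by blast
  qed (rule T(1))
  ultimately show "continuous (at t within {0..1}) (\<lambda>s. rnorm g (\<gamma> s) (velocity A \<gamma> s))"
    by simp
qed

end

lemma norm_trilinear_le: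
  fixes F :: "'a::real_normed_vector \<Rightarrow>\<^sub>L 'b::real_normed_vector \<Rightarrow>\<^sub>L 'c::real_normed_vector \<Rightarrow>\<^sub>L real"
  shows "\<bar>F u v w\<bar> \<le> norm F * norm u * norm v * norm w"
proof -
  have "\<bar>F u v w\<bar> \<le> norm (F u v) * norm w" using norm_blinfun[of "F u v" w] by simp
  also have "\<dots> \<le> norm (F u) * norm v * norm w" by (intro mult_right_mono norm_blinfun) auto
  also have "\<dots> \<le> norm F * norm u * norm v * norm w" by (intro mult_right_mono norm_blinfun) auto
  finally show ?thesis .
qed

lemma norm_bilinear_le:
  fixes F :: "'b::real_normed_vector \<Rightarrow>\<^sub>L 'c::real_normed_vector \<Rightarrow>\<^sub>L real"
  shows "\<bar>F v w\<bar> \<le> norm F * norm v * norm w"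
proof -
  have "\<bar>F v w\<bar> \<le> norm (F v) * norm w" using norm_blinfun[of "F v" w] by simp
  also have "\<dots> \<le> norm F * norm v * norm w" by (intro mult_right_mono norm_blinfun) auto
  finally show ?thesis .
qed

text \<open>
  A coordinate ball on which the geometry is uniformly comparable with that of the model space: \<open>m\<close> and
  \<open>M\<close> compare the norms, \<open>C\<close> bounds the Christoffel symbols. Every point has one
  (\<open>controlled_chart_ball_exists\<close>), and all estimates for geodesics and for \<open>H\<close> are in terms of these
  constants.
\<close>
locale controlled_chart_ball = riemannian A g
  for A :: "('m::t2_space, 'h::{real_inner,banach}) chart set" and g :: "('m, 'h) metric" +
  fixes c :: "('m, 'h) chart" and p\<^sub>0 :: 'h and r m M C :: real
  assumes chart: "c \<in> A" and pos: "0 < r" "0 < m" "0 < M" "0 \<le> C"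
    and ball_in_range: "ball p\<^sub>0 r \<subseteq> snd c ` fst c"
    and rnorm_lower: "\<And>x v. x \<in> fst c \<Longrightarrow> snd c x \<in> ball p\<^sub>0 r \<Longrightarrow> v \<in> tangent_space A x
      \<Longrightarrow> m * norm (v c) \<le> rnorm g x v"
    and rnorm_upper: "\<And>x v. x \<in> fst c \<Longrightarrow> snd c x \<in> ball p\<^sub>0 r \<Longrightarrow> v \<in> tangent_space A x
      \<Longrightarrow> rnorm g x v \<le> M * norm (v c)"
    and christoffel_bound: "\<And>p u v z. p \<in> ball p\<^sub>0 r \<Longrightarrow> is_christoffel A g c p u v z
      \<Longrightarrow> norm z \<le> C * norm u * norm v"

context riemannian
begin

lemma is_christoffel_imp_eq:
  assumes c: "c \<in> A"
    and B: "\<And>x v w. x \<in> fst c \<Longrightarrow> v \<in> tangent_space A x \<Longrightarrow> w \<in> tangent_space A x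
           \<Longrightarrow> g x v w = blinfun_apply (blinfun_apply (B (snd c x)) (v c)) (w c)"
    and B': "\<And>p. p \<in> snd c ` fst c \<Longrightarrow> (B has_derivative blinfun_apply (B' p)) (at p)"
    and p: "p \<in> snd c ` fst c" and z: "is_christoffel A g c p u v z"
  shows "2 * B p z w = B' p u v w + B' p v u w - B' p w u v"
proof -
  have cm: "coord_metric A g c q a b = B q a b" if "q \<in> snd c ` fst c" for q a b
  proof -
    have x: "chart_inv c q \<in> fst c" and "c \<in> charts_at A (chart_inv c q)"
      using chart_inv_in_domain[OF c that] c by (auto simp: charts_at_def)
    then show ?thesis
      using B[OF x] chart_chart_inv[OF c that]
      by (simp add: coord_metric_def tvector_of_in_tangent_space tvector_of_coord)
  qed
  have fd: "frechet_derivative (\<lambda>q. coord_metric A g c q b e) (at p) a = B' p a b e" for a b e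
  proof -
    have "((\<lambda>q. blinfun_apply (blinfun_apply (B q) b) e) has_derivative (\<lambda>a. B' p a b e)) (at p)"
      by (auto intro!: derivative_eq_intros B' p simp: blinfun.bilinear_simps)
    then have "((\<lambda>q. coord_metric A g c q b e) has_derivative (\<lambda>a. B' p a b e)) (at p)"
      by (rule has_derivative_transform_within_open[OF _ open_chart_range[OF c] p]) (simp add: cm)
    from fun_cong[OF frechet_derivative_at[OF this], of a] show ?thesis by simp
  qed
  show ?thesis
    using z unfolding is_christoffel_def Let_def fd by (simp add: cm[OF p])
qed

text \<open>
  All bounds hold at the centre and persist nearby by continuity. For the Christoffel symbol
  \<open>z = \<Gamma>(u, v)\<close>, testing the Koszul formula with \<open>w = z\<close> and using coercivity gives
  \<open>k \<parallel>z\<parallel>\<^sup>2 \<le> 3 N \<parallel>u\<parallel> \<parallel>v\<parallel> \<parallel>z\<parallel>\<close>.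
\<close>
lemma controlled_chart_ball_exists:
  assumes c: "c \<in> A" and x: "x \<in> fst c"
  shows "\<exists>r m M C. controlled_chart_ball A g c (snd c x) r m M C"
proof -
  obtain B B' where
    B: "\<And>x v w. x \<in> fst c \<Longrightarrow> v \<in> tangent_space A x \<Longrightarrow> w \<in> tangent_space A x
           \<Longrightarrow> g x v w = blinfun_apply (blinfun_apply (B (snd c x)) (v c)) (w c)" and
    B': "\<And>p. p \<in> snd c ` fst c \<Longrightarrow> (B has_derivative blinfun_apply (B' p)) (at p)" and
    B'c: "continuous_on (snd c ` fst c) B'" and
    coercive: "\<And>p. p \<in> snd c ` fst c \<Longrightarrow> \<exists>k>0. \<forall>u. k * (norm u)\<^sup>2 \<le> B p u u"
    by (rule metric_in_chart[OF c]) blast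
  define p where "p = snd c x"
  have p: "p \<in> snd c ` fst c" using x by (simp add: p_def)
  obtain k where k: "k > 0" "\<And>u. k * (norm u)\<^sup>2 \<le> B p u u" using coercive[OF p] by blast
  obtain d where d: "d > 0" "ball p d \<subseteq> snd c ` fst c"
    using open_chart_range[OF c] p by (meson open_contains_ball)
  have "isCont B p" using B'[OF p] has_derivative_continuous by blast
  then obtain d1 where d1: "d1 > 0" "\<And>q. dist q p < d1 \<Longrightarrow> dist (B q) (B p) < k / 2"
    unfolding continuous_at_eps_delta using k(1) half_gt_zero by blast
  have "isCont B' p" using B'c continuous_on_eq_continuous_at[OF open_chart_range[OF c]] p by blast
  then obtain d2 where d2: "d2 > 0" "\<And>q. dist q p < d2 \<Longrightarrow> dist (B' q) (B' p) < 1"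
    unfolding continuous_at_eps_delta using zero_less_one by blast
  define r where "r = min d (min d1 d2)"
  define N where "N = norm (B' p) + 1"
  have near: "k / 2 * (norm u)\<^sup>2 \<le> B q u u" "B q u u \<le> (norm (B p) + k) * (norm u)\<^sup>2" "norm (B' q) \<le> N"
    if "q \<in> ball p r" for q u
  proof -
    have q: "dist q p < d1" "dist q p < d2" using that by (auto simp: r_def dist_commute)
    have "\<bar>(B q - B p) u u\<bar> \<le> norm (B q - B p) * norm u * norm u" by (rule norm_bilinear_le)
    also have "\<dots> \<le> k / 2 * norm u * norm u"
      using d1(2)[OF q(1)] by (intro mult_right_mono) (auto simp: dist_norm)
    finally have diff: "\<bar>B q u u - B p u u\<bar> \<le> k / 2 * (norm u)\<^sup>2"
      by (simp add: blinfun.diff_left power2_eq_square)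
    have half: "k / 2 * (norm u)\<^sup>2 + k / 2 * (norm u)\<^sup>2 = k * (norm u)\<^sup>2"
      by (simp add: field_simps)
    have "\<bar>B p u u\<bar> \<le> norm (B p) * (norm u)\<^sup>2"
      using norm_bilinear_le[of "B p" u u] by (simp add: power2_eq_square)
    moreover have "k / 2 * (norm u)\<^sup>2 \<le> k * (norm u)\<^sup>2" using k(1) by (simp add: mult_right_mono)
    ultimately show "B q u u \<le> (norm (B p) + k) * (norm u)\<^sup>2"
      using diff unfolding distrib_right by linarith
    show "k / 2 * (norm u)\<^sup>2 \<le> B q u u" using diff k(2)[of u] half by linarith
    have "norm (B' q) \<le> norm (B' p) + norm (B' q - B' p)" by (metis norm_triangle_sub)
    then show "norm (B' q) \<le> N" using d2(2)[OF q(2)] by (simp add: dist_norm N_def)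
  qed
  have "controlled_chart_ball A g c p r (sqrt (k / 2)) (sqrt (norm (B p) + k)) (3 * N / k)"
  proof unfold_locales
    show "0 < r" "0 < sqrt (k / 2)" "0 < sqrt (norm (B p) + k)" "0 \<le> 3 * N / k"
      using d d1 d2 k by (auto simp: r_def N_def add_nonneg_pos)
    show "ball p r \<subseteq> snd c ` fst c" using d(2) by (auto simp: r_def)
    fix y v assume y: "y \<in> fst c" "snd c y \<in> ball p r" and v: "v \<in> tangent_space A y"
    have eq: "rnorm g y v = sqrt (B (snd c y) (v c) (v c))" using B[OF y(1) v v] by (simp add: rnorm_def)
    have "sqrt (k / 2 * (norm (v c))\<^sup>2) \<le> rnorm g y v"
      unfolding eq by (rule real_sqrt_le_mono) (rule near(1)[OF y(2)])
    then show "sqrt (k / 2) * norm (v c) \<le> rnorm g y v" unfolding real_sqrt_mult by simp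
    have "rnorm g y v \<le> sqrt ((norm (B p) + k) * (norm (v c))\<^sup>2)"
      unfolding eq by (rule real_sqrt_le_mono) (rule near(2)[OF y(2)])
    then show "rnorm g y v \<le> sqrt (norm (B p) + k) * norm (v c)" unfolding real_sqrt_mult by simp
  next
    fix q u v z assume q: "q \<in> ball p r" and z: "is_christoffel A g c q u v z"
    have qE: "q \<in> snd c ` fst c" using q d(2) by (auto simp: r_def)
    have b: "\<bar>B' q a b e\<bar> \<le> N * norm a * norm b * norm e" for a b e
      by (rule order_trans[OF norm_trilinear_le]) (intro mult_right_mono near(3)[OF q] norm_ge_zero)
    have "k * (norm z * norm z) \<le> 2 * B q z z" using near(1)[OF q, of z] by (simp add: power2_eq_square)
    also have "\<dots> = B' q u v z + B' q v u z - B' q z u v"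
      by (rule is_christoffel_imp_eq[where B = B and B' = B', OF c B B' qE z])
    also have "\<dots> \<le> 3 * (N * norm u * norm v * norm z)"
      using b[of u v z] b[of v u z] b[of z u v] by (simp add: mult_ac)
    finally have "norm z * (k * norm z) \<le> norm z * (3 * N * norm u * norm v)" by (simp add: mult_ac)
    then have "norm z = 0 \<or> k * norm z \<le> 3 * N * norm u * norm v"
      by (metis mult_le_cancel_left norm_ge_zero order_le_less)
    moreover have "0 \<le> N" by (simp add: N_def)
    ultimately show "norm z \<le> 3 * N / k * norm u * norm v"
      using k(1) by (auto simp: field_simps)
  qed (fact c)
  then show ?thesis unfolding p_def by blast
qed

end

section \<open>Curves that cannot leave a coordinate ball\<close>

context smooth_manifold
begin

text \<open>
  Consider the first time at which the curve would be outside the ball. Before it, the increments of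
  the coordinates are bounded by those of the integral of \<open>\<sigma>\<close>, so the coordinates are uniformly
  continuous and converge, by completeness, to a limit at distance less than \<open>\<rho>\<close> from the centre. As
  limits in the manifold are unique, the curve is at this limit, inside the ball: a contradiction. The
  bound on the derivative is required only while the curve is in the ball, which is all that is known
  in the applications.
\<close>
lemma curve_confined_to_chart_ball:
  assumes c: "c \<in> A" and ball: "ball p \<rho> \<subseteq> snd c ` fst c"
    and cont: "continuous_on {0..1} \<gamma>" and start: "\<gamma> 0 \<in> fst c"
    and \<sigma>: "continuous_on {0..1} \<sigma>" and \<sigma>0: "\<And>t. t \<in> {0..1} \<Longrightarrow> 0 \<le> \<sigma> t"
    and der: "\<And>t. t \<in> {0..1} \<Longrightarrow> \<gamma> t \<in> fst c \<Longrightarrow> snd c (\<gamma> t) \<in> ball p \<rho>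
      \<Longrightarrow> \<exists>v. ((snd c \<circ> \<gamma>) has_vector_derivative v) (at t within {0..1}) \<and> norm v \<le> \<sigma> t"
    and len: "dist p (snd c (\<gamma> 0)) + integral {0..1} \<sigma> < \<rho>"
    and t: "t \<in> {0..1}"
  shows "\<gamma> t \<in> fst c" and "snd c (\<gamma> t) \<in> ball p \<rho>"
    and "dist (snd c (\<gamma> 0)) (snd c (\<gamma> t)) \<le> integral {0..1} \<sigma>"
proof -
  define W where "W = {x \<in> fst c. snd c x \<in> ball p \<rho>}"
  define f where "f = snd c \<circ> \<gamma>"
  define I where "I t = integral {0..t} \<sigma>" for t
  have "openin (top_of_set (fst c)) (fst c \<inter> snd c -` ball p \<rho>)"
    by (intro continuous_openin_preimage_gen continuous_on_chart c) auto
  moreover have "fst c \<inter> snd c -` ball p \<rho> = W" by (auto simp: W_def)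
  ultimately have openW: "open W"
    using open_chart_domain[OF c] openin_open_trans by fastforce
  have I_der: "(I has_vector_derivative \<sigma> s) (at s within {0..1})" if "s \<in> {0..1}" for s
    unfolding I_def by (rule integral_has_vector_derivative[OF \<sigma> that])
  have I_cont: "continuous_on {0..1} I"
    using I_der continuous_on_eq_continuous_within has_vector_derivative_continuous by blast
  have I_mono: "I s \<le> I 1" if "s \<in> {0..1}" for s
    unfolding I_def
    by (rule integral_subset_le)
      (use that \<sigma> \<sigma>0 integrable_continuous_interval continuous_on_subset[OF \<sigma>, of "{0..s}"] in auto)
  have I0: "I 0 = 0" by (simp add: I_def)
  have step: "norm (f s' - f s) \<le> I s' - I s"
    if W: "\<And>a. a \<in> {0..s'} \<Longrightarrow> \<gamma> a \<in> W" and s: "0 \<le> s" "s \<le> s'" "s' \<le> 1" for s s'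
  proof (cases "s = s'")
    case False
    have "\<exists>v. (f has_vector_derivative v) (at a within {0..1}) \<and> norm v \<le> \<sigma> a" if "a \<in> {0..s'}" for a
      using W[OF that] der[of a] that s unfolding W_def f_def by auto
    then obtain v where v: "\<And>a. a \<in> {0..s'} \<Longrightarrow> (f has_vector_derivative v a) (at a within {0..1})"
        "\<And>a. a \<in> {0..s'} \<Longrightarrow> norm (v a) \<le> \<sigma> a"
      by metis
    have interior: "at a within {0..1} = at a" if "s < a" "a < s'" for a
      using that s by (intro at_within_interior) (auto simp: interior_atLeastAtMost_real)
    show ?thesis
    proof (rule differentiable_bound_general)
      show "s < s'" using False s by simp
      have "continuous_on {0..s'} f"
        using v(1) has_vector_derivative_continuous s
        unfolding continuous_on_eq_continuous_within
        by (metis (no_types, lifting) atLeastatMost_subset_iff continuous_within_subset order_refl)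
      then show "continuous_on {s..s'} f"
        by (rule continuous_on_subset) (use s in auto)
      show "continuous_on {s..s'} I"
        by (rule continuous_on_subset[OF I_cont]) (use s in auto)
      show "(f has_vector_derivative v a) (at a)" if "s < a" "a < s'" for a
        using v(1)[of a] interior[OF that] that s by simp
      show "(I has_vector_derivative \<sigma> a) (at a)" if "s < a" "a < s'" for a
        using I_der[of a] interior[OF that] that s by simp
      show "norm (v a) \<le> \<sigma> a" if "s < a" "a < s'" for a
        using v(2) that s by auto
    qed
  qed simp
  have "0 \<le> I 1" using I_mono[of 0] I0 by simp
  then have W0: "\<gamma> 0 \<in> W" using start len by (simp add: W_def I_def)
  have allW: "\<gamma> t \<in> W" if "t \<in> {0..1}" for t
  proof (rule ccontr)
    assume "\<gamma> t \<notin> W"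
    \<comment> \<open>The set of bad times is compact, so there is a first one.\<close>
    define Bad where "Bad = {0..1} \<inter> \<gamma> -` (- W)"
    have "closed Bad"
      unfolding Bad_def by (intro continuous_closed_preimage cont) (use openW in auto)
    then have "compact Bad"
      using closed_Int_compact[OF _ compact_Icc, of Bad 0 1] by (simp add: Bad_def Int_ac)
    moreover have "Bad \<noteq> {}" using that \<open>\<gamma> t \<notin> W\<close> by (auto simp: Bad_def)
    ultimately obtain t1 where t1: "t1 \<in> Bad" "\<And>s. s \<in> Bad \<Longrightarrow> t1 \<le> s"
      using compact_attains_inf by metis
    have t1': "0 < t1" "t1 \<le> 1" "\<gamma> t1 \<notin> W"
      using t1(1) W0 unfolding Bad_def by (auto simp: less_eq_real_def)
    have good: "\<gamma> a \<in> W" if "a \<in> {0..<t1}" for a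
      using t1(2)[of a] that t1' by (auto simp: Bad_def)
    have lip: "dist (f s') (f s) \<le> dist (I s') (I s)" if "s \<in> {0..<t1}" "s' \<in> {0..<t1}" for s s'
    proof (cases "s \<le> s'")
      case True
      then show ?thesis using step[of s' s] good that t1' by (auto simp: dist_norm)
    next
      case False
      then show ?thesis using step[of s s'] good that t1' by (auto simp: dist_norm norm_minus_commute)
    qed
    have "uniformly_continuous_on {0..<t1} f"
      unfolding uniformly_continuous_on_def
    proof (intro allI impI)
      fix e :: real assume "0 < e"
      then obtain d where "d > 0" and
        d: "\<And>s s'. s \<in> {0..1} \<Longrightarrow> s' \<in> {0..1} \<Longrightarrow> dist s' s < d \<Longrightarrow> dist (I s') (I s) < e"
        using compact_uniformly_continuous[OF I_cont compact_Icc]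
        unfolding uniformly_continuous_on_def by metis
      then show "\<exists>d>0. \<forall>s\<in>{0..<t1}. \<forall>s'\<in>{0..<t1}. dist s' s < d \<longrightarrow> dist (f s') (f s) < e"
        using t1' by (intro exI[of _ d]) (auto intro!: le_less_trans[OF lip] d)
    qed
    moreover have t1cl: "t1 \<in> closure {0..<t1}" using t1' by simp
    ultimately obtain l where l: "(f \<longlongrightarrow> l) (at t1 within {0..<t1})"
      using uniformly_continuous_on_extension_at_closure by blast
    have nt: "at t1 within {0..<t1} \<noteq> bot"
      using t1cl by (simp add: trivial_limit_within islimpt_in_closure)
    have "dist p (f s) \<le> dist p (snd c (\<gamma> 0)) + I 1" if "s \<in> {0..<t1}" for s
    proof -
      have "dist (f 0) (f s) \<le> I s"
        using step[of s 0] good that t1' I0 by (auto simp: dist_norm norm_minus_commute)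
      also have "\<dots> \<le> I 1" using I_mono that t1' by auto
      finally show ?thesis using dist_triangle[of p "f s" "f 0"] by (simp add: f_def)
    qed
    then have "\<forall>\<^sub>F s in at t1 within {0..<t1}. dist p (f s) \<le> dist p (snd c (\<gamma> 0)) + I 1"
      by (auto simp: eventually_at_filter)
    then have "dist p l \<le> dist p (snd c (\<gamma> 0)) + I 1"
      using tendsto_upperbound[OF tendsto_dist[OF tendsto_const l] _ nt] by blast
    then have lb: "l \<in> ball p \<rho>" using len by (simp add: I_def)
    then have lE: "l \<in> snd c ` fst c" using ball by blast
    have "isCont (chart_inv c) l"
      using continuous_on_chart_inv[OF c] lE continuous_on_eq_continuous_at[OF open_chart_range[OF c]] by blast
    then have "((\<lambda>s. chart_inv c (f s)) \<longlongrightarrow> chart_inv c l) (at t1 within {0..<t1})"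
      using l by (rule isCont_tendsto_compose)
    moreover have "\<forall>\<^sub>F s in at t1 within {0..<t1}. chart_inv c (f s) = \<gamma> s"
      using good chart_inv_chart[OF c] by (auto simp: eventually_at_filter W_def f_def)
    ultimately have "(\<gamma> \<longlongrightarrow> chart_inv c l) (at t1 within {0..<t1})"
      using tendsto_cong by fast
    moreover have "(\<gamma> \<longlongrightarrow> \<gamma> t1) (at t1 within {0..<t1})"
    proof -
      have "continuous (at t1 within {0..1}) \<gamma>"
        using cont t1' by (simp add: continuous_on_eq_continuous_within)
      moreover have "{0..<t1} \<subseteq> {0..1}" using t1' by auto
      ultimately show ?thesis using continuous_within_subset continuous_within by blast
    qed
    ultimately have "\<gamma> t1 = chart_inv c l" using tendsto_unique nt by blast
    then have "\<gamma> t1 \<in> W"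
      using lb lE chart_inv_in_domain[OF c] chart_chart_inv[OF c] by (simp add: W_def)
    then show False using t1' by simp
  qed
  show "\<gamma> t \<in> fst c" "snd c (\<gamma> t) \<in> ball p \<rho>" using allW[OF t] by (auto simp: W_def)
  have "norm (f t - f 0) \<le> I t - I 0" using t by (intro step allW) auto
  then show "dist (snd c (\<gamma> 0)) (snd c (\<gamma> t)) \<le> integral {0..1} \<sigma>"
    using I_mono[OF t] I0 by (simp add: f_def I_def dist_norm norm_minus_commute)
qed

end

section \<open>Short geodesics and parallel transport in coordinates\<close>

context controlled_chart_ball
begin

text \<open>
  The coordinate segment is an admissible curve of length at most \<open>M * norm (q - p)\<close>.
\<close>
lemma rdist_le_coord_dist:
  assumes p: "p \<in> ball p\<^sub>0 r" and q: "q \<in> ball p\<^sub>0 r"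
  shows "rdist A g (chart_inv c p) (chart_inv c q) \<le> ennreal (M * norm (q - p))"
proof -
  define s where "s t = p + t *\<^sub>R (q - p)" for t
  define \<gamma> where "\<gamma> = chart_inv c \<circ> s"
  have s: "s t \<in> ball p\<^sub>0 r" if "t \<in> {0..1}" for t
  proof -
    have "s t = (1 - t) *\<^sub>R p + t *\<^sub>R q" by (simp add: s_def algebra_simps)
    then show ?thesis using convexD[OF convex_ball p q, of "1 - t" t] that by auto
  qed
  have s_der: "(s has_vector_derivative (q - p)) (at t within S)" for t S
    unfolding s_def by (auto intro!: derivative_eq_intros)
  have s_cont: "continuous_on S s" for S
    unfolding s_def by (intro continuous_intros)
  have \<gamma>: "\<gamma> t \<in> fst c" "snd c (\<gamma> t) = s t" if "t \<in> {0..1}" for t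
    using s[OF that] ball_in_range chart_inv_in_domain[OF chart] chart_chart_inv[OF chart]
    by (auto simp: \<gamma>_def)
  have \<gamma>_cont: "continuous_on {0..1} \<gamma>"
    unfolding \<gamma>_def
    by (intro continuous_on_compose s_cont continuous_on_subset[OF continuous_on_chart_inv[OF chart]])
      (use s ball_in_range in blast)
  have C1: "C1_curve_on A 0 1 \<gamma>"
    unfolding C1_curve_on_def
  proof (intro conjI \<gamma>_cont ballI)
    fix d assume d: "d \<in> A"
    have op: "open (snd c ` (fst c \<inter> fst d))"
      by (rule open_chart_image[OF chart open_chart_domain[OF d]])
    obtain D where Dc: "continuous_on (snd c ` (fst c \<inter> fst d)) D" and
      D: "\<And>a. a \<in> snd c ` (fst c \<inter> fst d) \<Longrightarrow>
        ((snd d \<circ> chart_inv c) has_derivative blinfun_apply (D a)) (at a)"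
      by (rule smooth_on_imp_C1[OF transition_smooth[OF chart d] op]) blast
    have in_dom: "s t \<in> snd c ` (fst c \<inter> fst d)" if "t \<in> {0..1} \<inter> \<gamma> -` fst d" for t
      using that \<gamma>[of t] by (metis Int_iff image_eqI vimageE)
    have "continuous_on ({0..1} \<inter> \<gamma> -` fst d) (\<lambda>t. D (s t) (q - p))"
      by (intro continuous_intros continuous_on_compose2[OF Dc s_cont]) (use in_dom in blast)
    moreover have "((snd d \<circ> \<gamma>) has_vector_derivative D (s t) (q - p)) (at t within {0..1})"
      if "t \<in> {0..1} \<inter> \<gamma> -` fst d" for t
      unfolding \<gamma>_def comp_assoc[symmetric]
      by (rule vector_derivative_diff_chain_within[OF s_der has_derivative_at_withinI[OF D[OF in_dom[OF that]]]])
    ultimately show "\<exists>D. continuous_on ({0..1} \<inter> \<gamma> -` fst d) D \<and>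
      (\<forall>t\<in>{0..1} \<inter> \<gamma> -` fst d. ((snd d \<circ> \<gamma>) has_vector_derivative D t) (at t within {0..1}))"
      by blast
  qed
  have speed: "rnorm g (\<gamma> t) (velocity A \<gamma> t) \<le> M * norm (q - p)" if t: "t \<in> {0..1}" for t
  proof -
    have "((snd c \<circ> \<gamma>) has_vector_derivative (q - p)) (at t within {0..1})"
      unfolding has_vector_derivative_def
      by (rule has_derivative_transform[OF t _ s_der[unfolded has_vector_derivative_def]])
        (simp add: \<gamma>)
    then have "velocity A \<gamma> t c = q - p"
      using vector_derivative_within_cbox[of 0 1 t, unfolded cbox_interval, OF zero_less_one t]
        \<gamma>(1)[OF t] chart by (simp add: velocity_def charts_at_def)
    then show ?thesis
      using rnorm_upper[OF \<gamma>(1)[OF t] _ velocity_in_tangent_space[OF C1 t]] \<gamma>(2)[OF t] s[OF t] by simp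
  qed
  have "curve_length A g \<gamma> \<le> integral {0..1} (\<lambda>t::real. M * norm (q - p))"
    unfolding curve_length_def
    by (rule integral_le) (use speed integrable_continuous_interval[OF continuous_on_speed[OF C1]] in auto)
  then have len: "curve_length A g \<gamma> \<le> M * norm (q - p)" by simp
  have "piecewise_C1_curve A \<gamma>"
    unfolding piecewise_C1_curve_def by (rule exI[of _ "{0, 1}"]) (use C1 in auto)
  moreover have "\<gamma> 0 = chart_inv c p" "\<gamma> 1 = chart_inv c q" by (auto simp: \<gamma>_def s_def)
  ultimately have "rdist A g (chart_inv c p) (chart_inv c q) \<le> ennreal (curve_length A g \<gamma>)"
    unfolding rdist_def by (intro INF_lower) auto
  also have "\<dots> \<le> ennreal (M * norm (q - p))" by (intro ennreal_leI len)
  finally show ?thesis .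
qed

text \<open>
  The length of a minimizing geodesic is the distance of its ends, and \<open>1 / m\<close> times its speed bounds
  the speed of the coordinates.
\<close>
lemma short_geodesic_confined:
  assumes geo: "minimizing_geodesic A g x y \<gamma>" and x: "x \<in> fst c"
    and short: "rdist A g x y \<le> ennreal (m * \<eta>)" and "0 \<le> \<eta>"
    and room: "dist p\<^sub>0 (snd c x) + \<eta> < r"
  shows "t \<in> {0..1} \<Longrightarrow> \<gamma> t \<in> fst c" and "t \<in> {0..1} \<Longrightarrow> snd c (\<gamma> t) \<in> ball p\<^sub>0 r"
    and "t \<in> {0..1} \<Longrightarrow> dist (snd c x) (snd c (\<gamma> t)) \<le> \<eta>"
    and "integral {0..1} (\<lambda>t. rnorm g (\<gamma> t) (velocity A \<gamma> t)) \<le> m * \<eta>"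
proof -
  define \<sigma> where "\<sigma> t = rnorm g (\<gamma> t) (velocity A \<gamma> t) / m" for t
  have C1: "C1_curve_on A 0 1 \<gamma>" and ends: "\<gamma> 0 = x" "\<gamma> 1 = y"
    and min: "ennreal (curve_length A g \<gamma>) = rdist A g x y"
    using geo by (auto simp: minimizing_geodesic_def)
  have "ennreal (curve_length A g \<gamma>) \<le> ennreal (m * \<eta>)" using min short by simp
  then show len: "integral {0..1} (\<lambda>t. rnorm g (\<gamma> t) (velocity A \<gamma> t)) \<le> m * \<eta>"
    using pos \<open>0 \<le> \<eta>\<close> by (simp add: curve_length_def)
  have \<sigma>_cont: "continuous_on {0..1} \<sigma>"
    unfolding \<sigma>_def by (intro continuous_intros continuous_on_speed[OF C1]) (use pos in auto)
  \<comment> \<open>The curve is not yet known to stay in the chart \<open>c\<close>, so another ball is used at each of its points.\<close>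
  have rn: "0 \<le> rnorm g (\<gamma> t) (velocity A \<gamma> t)" if "t \<in> {0..1}" for t
  proof -
    obtain d where d: "d \<in> charts_at A (\<gamma> t)" using charts_at_nonempty by blast
    obtain r' m' M' C' where nb: "controlled_chart_ball A g d (snd d (\<gamma> t)) r' m' M' C'"
      using controlled_chart_ball_exists[OF charts_atD[OF d]] by blast
    have "snd d (\<gamma> t) \<in> ball (snd d (\<gamma> t)) r'" "0 \<le> m' * norm (velocity A \<gamma> t d)"
      using controlled_chart_ball.pos(1,2)[OF nb] by auto
    then show ?thesis
      using controlled_chart_ball.rnorm_lower[OF nb charts_atD(2)[OF d] _ velocity_in_tangent_space[OF C1 that]]
      by (meson order_trans)
  qed
  have int: "integral {0..1} \<sigma> \<le> \<eta>"
    using len pos unfolding \<sigma>_def by (simp add: field_simps)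
  have der: "\<exists>v. ((snd c \<circ> \<gamma>) has_vector_derivative v) (at t within {0..1}) \<and> norm v \<le> \<sigma> t"
    if t: "t \<in> {0..1}" and dom: "\<gamma> t \<in> fst c" and b: "snd c (\<gamma> t) \<in> ball p\<^sub>0 r" for t
  proof -
    obtain D where "\<forall>t \<in> {0..1} \<inter> \<gamma> -` fst c. ((snd c \<circ> \<gamma>) has_vector_derivative D t) (at t within {0..1})"
      using C1 chart unfolding C1_curve_on_def by blast
    then obtain v where v: "((snd c \<circ> \<gamma>) has_vector_derivative v) (at t within {0..1})"
      using t dom by blast
    then have "velocity A \<gamma> t c = v"
      using vector_derivative_within_cbox[of 0 1 t, unfolded cbox_interval, OF zero_less_one t]
        dom chart by (simp add: velocity_def charts_at_def)
    then have "m * norm v \<le> rnorm g (\<gamma> t) (velocity A \<gamma> t)"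
      using rnorm_lower[OF dom b velocity_in_tangent_space[OF C1 t]] by simp
    then show ?thesis using v pos by (auto simp: \<sigma>_def field_simps)
  qed
  have cont: "continuous_on {0..1} \<gamma>" using C1 by (simp add: C1_curve_on_def)
  have room': "dist p\<^sub>0 (snd c (\<gamma> 0)) + integral {0..1} \<sigma> < r" using int room ends by simp
  have "\<gamma> 0 \<in> fst c" and \<sigma>0: "\<And>t. t \<in> {0..1} \<Longrightarrow> 0 \<le> \<sigma> t"
    using ends x rn pos by (auto simp: \<sigma>_def)
  note confined = curve_confined_to_chart_ball[OF chart ball_in_range cont this(1) \<sigma>_cont _ _ room']
  show "\<gamma> t \<in> fst c" if "t \<in> {0..1}"
    by (rule confined(1)[OF _ _ that]) (fact \<sigma>0, rule der)
  show "snd c (\<gamma> t) \<in> ball p\<^sub>0 r" if "t \<in> {0..1}"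
    by (rule confined(2)[OF _ _ that]) (fact \<sigma>0, rule der)
  have "dist (snd c (\<gamma> 0)) (snd c (\<gamma> t)) \<le> integral {0..1} \<sigma>" if "t \<in> {0..1}"
    by (rule confined(3)[OF _ _ that]) (fact \<sigma>0, rule der)
  then show "dist (snd c x) (snd c (\<gamma> t)) \<le> \<eta>" if "t \<in> {0..1}"
    using that int ends by simp
qed

text \<open>
  A Gronwall estimate without exponentials. If \<open>N\<close> is the maximum of \<open>norm V\<close> along the curve, then
  \<open>norm (V t - V 0) \<le> C \<eta> N\<close>; as \<open>C \<eta> \<le> 1 / 2\<close>, the maximum is at most twice the initial norm.
\<close>
lemma parallel_transport_near_identity:
  assumes geo: "minimizing_geodesic A g x y \<gamma>" and x: "x \<in> fst c"
    and short: "rdist A g x y \<le> ennreal (m * \<eta>)" and "0 \<le> \<eta>"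
    and room: "dist p\<^sub>0 (snd c x) + \<eta> < r"
    and par: "parallel_along A g \<gamma> V" and small: "C * \<eta> \<le> 1 / 2"
  shows "norm (V 1 c - V 0 c) \<le> 2 * C * \<eta> * norm (V 0 c)"
proof -
  note conf = short_geodesic_confined[OF geo x short \<open>0 \<le> \<eta>\<close> room]
  define sp where "sp = (\<lambda>t. rnorm g (\<gamma> t) (velocity A \<gamma> t))"
  define v where "v = (\<lambda>t. V t c)"
  have C1: "C1_curve_on A 0 1 \<gamma>" using geo by (simp add: minimizing_geodesic_def)
  have sp_cont: "continuous_on {0..1} sp"
    unfolding sp_def by (rule continuous_on_speed[OF C1])
  have "\<exists>z. norm z \<le> C / m * sp t * norm (v t) \<and> (v has_vector_derivative - z) (at t within {0..1})"
    if t: "t \<in> {0..1}" for t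
  proof -
    have "c \<in> charts_at A (\<gamma> t)" using conf(1)[OF t] chart by (simp add: charts_at_def)
    then obtain z where z: "is_christoffel A g c (snd c (\<gamma> t)) (velocity A \<gamma> t c) (V t c) z"
      "((\<lambda>s. V s c) has_vector_derivative - z) (at t within {0..1})"
      using par t unfolding parallel_along_def by blast
    have "m * norm (velocity A \<gamma> t c) \<le> sp t"
      unfolding sp_def by (rule rnorm_lower[OF conf(1)[OF t] conf(2)[OF t] velocity_in_tangent_space[OF C1 t]])
    then have "norm (velocity A \<gamma> t c) \<le> sp t / m" using pos by (simp add: field_simps)
    then have "C * norm (velocity A \<gamma> t c) * norm (V t c) \<le> C * (sp t / m) * norm (V t c)"
      using pos by (intro mult_left_mono mult_right_mono) auto
    then show ?thesis using christoffel_bound[OF conf(2)[OF t] z(1)] z(2)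
      by (intro exI[of _ z]) (auto simp: v_def)
  qed
  then obtain z where z: "\<And>t. t \<in> {0..1} \<Longrightarrow> norm (z t) \<le> C / m * sp t * norm (v t)"
      "\<And>t. t \<in> {0..1} \<Longrightarrow> (v has_vector_derivative - z t) (at t within {0..1})"
    by metis
  have v_cont: "continuous_on {0..1} v"
    using z(2) continuous_on_eq_continuous_within has_vector_derivative_continuous by blast
  obtain T where T: "T \<in> {0..1}" "\<And>t. t \<in> {0..1} \<Longrightarrow> norm (v t) \<le> norm (v T)"
    using continuous_attains_sup[OF compact_Icc _ continuous_on_norm[OF v_cont]] by auto
  define N where "N = norm (v T)"
  define I where "I t = integral {0..t} sp" for t
  have I_der: "(I has_vector_derivative sp s) (at s within {0..1})" if "s \<in> {0..1}" for s
    unfolding I_def by (rule integral_has_vector_derivative[OF sp_cont that])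
  have sp0: "0 \<le> sp t" if "t \<in> {0..1}" for t
  proof -
    have "0 \<le> m * norm (velocity A \<gamma> t c)" using pos by simp
    also have "\<dots> \<le> sp t" unfolding sp_def
      by (rule rnorm_lower[OF conf(1)[OF that] conf(2)[OF that] velocity_in_tangent_space[OF C1 that]])
    finally show ?thesis .
  qed
  have "I s \<le> I 1" if "s \<in> {0..1}" for s
    unfolding I_def
    by (rule integral_subset_le)
      (use that sp0 integrable_continuous_interval[OF sp_cont]
        integrable_continuous_interval[OF continuous_on_subset[OF sp_cont, of "{0..s}"]] in auto)
  moreover have "I 1 \<le> m * \<eta>" using conf(4) by (simp add: I_def sp_def)
  ultimately have I_le: "I s \<le> m * \<eta>" if "s \<in> {0..1}" for s using that by fastforce
  have moved: "norm (v t - v 0) \<le> C * \<eta> * N" if t: "t \<in> {0..1}" for t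
  proof (cases "t = 0")
    case True
    then show ?thesis using pos \<open>0 \<le> \<eta>\<close> by (simp add: N_def)
  next
    case False
    have interior: "at a within {0..1} = at a" if "0 < a" "a < t" for a
      using that t by (intro at_within_interior) (auto simp: interior_atLeastAtMost_real)
    have "norm (v t - v 0) \<le> C / m * N * I t - C / m * N * I 0"
    proof (rule differentiable_bound_general)
      show "0 < t" using False t by simp
      show "continuous_on {0..t} v" by (rule continuous_on_subset[OF v_cont]) (use t in auto)
      have "continuous_on {0..1} I"
        using I_der continuous_on_eq_continuous_within has_vector_derivative_continuous by blast
      then have "continuous_on {0..t} I"
        by (rule continuous_on_subset) (use t in auto)
      then show "continuous_on {0..t} (\<lambda>t. C / m * N * I t)"
        by (intro continuous_intros)
      fix a assume a: "0 < a" "a < t"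
      then have a01: "a \<in> {0..1}" using t by auto
      show "(v has_vector_derivative - z a) (at a)" using z(2)[OF a01] interior[OF a] by simp
      have "(I has_vector_derivative sp a) (at a)" using I_der[OF a01] interior[OF a] by simp
      then show "((\<lambda>t. C / m * N * I t) has_vector_derivative C / m * N * sp a) (at a)"
        by (rule has_vector_derivative_mult_right)
      have "C / m * sp a * norm (v a) \<le> C / m * sp a * N"
        using T(2)[OF a01] sp0[OF a01] pos by (intro mult_left_mono) (auto simp: N_def)
      then show "norm (- z a) \<le> C / m * N * sp a" using z(1)[OF a01] by (simp add: mult_ac)
    qed
    also have "\<dots> = C / m * N * I t" by (simp add: I_def)
    also have "\<dots> \<le> C / m * N * (m * \<eta>)"
      using I_le[OF t] pos by (intro mult_left_mono) (auto simp: N_def)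
    also have "\<dots> = C * \<eta> * N" using pos by simp
    finally show ?thesis .
  qed
  have "N \<le> norm (v 0) + norm (v T - v 0)" unfolding N_def by (rule norm_triangle_sub)
  also have "\<dots> \<le> norm (v 0) + C * \<eta> * N" using moved[OF T(1)] by simp
  also have "C * \<eta> * N \<le> 1 / 2 * N" using small by (intro mult_right_mono) (auto simp: N_def)
  finally have "N \<le> 2 * norm (v 0)" by simp
  then have "C * \<eta> * N \<le> C * \<eta> * (2 * norm (v 0))"
    using pos \<open>0 \<le> \<eta>\<close> by (intro mult_left_mono) auto
  then show ?thesis using moved[of 1] by (simp add: v_def)
qed

end

section \<open>Maps that are close to the identity\<close>

context controlled_chart_ball
begin

text \<open>
  The triangle inequality between the derivative, the parallel transport and the identity. The
  transport is along a geodesic from \<open>y\<close> to \<open>H y\<close>, which is short since both points are near the centre.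
\<close>
lemma map_derivative_near_identity:
  assumes H: "differentiable_map A H"
    and y: "y \<in> fst c" "snd c y \<in> ball p\<^sub>0 r" and Hy: "H y \<in> fst c" "snd c (H y) \<in> ball p\<^sub>0 r"
    and L: "is_parallel_transport A g y (H y) L"
    and op: "op_norm A g y (H y) (\<lambda>v d. differential A H y v d - L v d) < \<delta>"
    and short: "M * norm (snd c (H y) - snd c y) \<le> m * \<eta>"
    and room: "dist p\<^sub>0 (snd c y) + \<eta> < r" and small: "C * \<eta> \<le> 1 / 2"
  shows "norm (frechet_derivative (map_rep H c c) (at (snd c y)) u - u) \<le> (M * \<delta> / m + 2 * C * \<eta>) * norm u"
proof -
  define J where "J = frechet_derivative (map_rep H c c) (at (snd c y))"
  have cy: "c \<in> charts_at A y" and cHy: "c \<in> charts_at A (H y)"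
    using chart y Hy by (auto simp: charts_at_def)
  have "bounded_linear J"
    using map_rep_has_derivative[OF H cy cHy] has_derivative_bounded_linear unfolding J_def by blast
  then interpret J: bounded_linear J .
  have "0 \<le> M * norm (snd c (H y) - snd c y)" using pos by simp
  then have "0 \<le> m * \<eta>" using short by linarith
  then have \<eta>: "0 \<le> \<eta>" using pos by (simp add: zero_le_mult_iff)
  have "rdist A g y (H y) \<le> ennreal (M * norm (snd c (H y) - snd c y))"
    using rdist_le_coord_dist[OF y(2) Hy(2)] chart_inv_chart[OF chart y(1)] chart_inv_chart[OF chart Hy(1)]
    by simp
  also have "\<dots> \<le> ennreal (m * \<eta>)" by (rule ennreal_leI[OF short])
  finally have dist: "rdist A g y (H y) \<le> ennreal (m * \<eta>)" .
  obtain \<gamma> where \<gamma>: "minimizing_geodesic A g y (H y) \<gamma>" and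
    V: "\<And>v. v \<in> tangent_space A y \<Longrightarrow> \<exists>V. parallel_along A g \<gamma> V \<and> V 0 = v \<and> V 1 = L v"
    using L unfolding is_parallel_transport_def by blast
  have L_near: "norm (L v c - v c) \<le> 2 * C * \<eta> * norm (v c)" and L_tan: "L v \<in> tangent_space A (H y)"
    if v: "v \<in> tangent_space A y" for v
  proof -
    obtain V where V: "parallel_along A g \<gamma> V" "V 0 = v" "V 1 = L v" using V[OF v] by blast
    show "norm (L v c - v c) \<le> 2 * C * \<eta> * norm (v c)"
      using parallel_transport_near_identity[OF \<gamma> y(1) dist \<eta> room V(1) small] V by simp
    have "V 1 \<in> tangent_space A (\<gamma> 1)" using V(1) unfolding parallel_along_def by simp
    then show "L v \<in> tangent_space A (H y)" using V \<gamma> by (simp add: minimizing_geodesic_def)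
  qed
  define w where "w v = (\<lambda>d. differential A H y v d - L v d)" for v
  have w_tan: "w v \<in> tangent_space A (H y)" if "v \<in> tangent_space A y" for v
    unfolding w_def by (rule tangent_space_diff[OF differential_in_tangent_space[OF H that] L_tan[OF that]])
  have w_c: "w v c = J (v c) - L v c" if "v \<in> tangent_space A y" for v
    unfolding w_def J_def using differential_coord[OF H cy cHy that] by simp
  let ?unit = "{v \<in> tangent_space A y. rnorm g y v \<le> 1}"
  obtain j where j: "0 < j" "\<And>u. norm (J u) \<le> norm u * j" using J.pos_bounded by blast
  \<comment> \<open>The supremum in the operator norm bounds its members only if they are bounded above.\<close>
  have bdd: "bdd_above ((\<lambda>v. rnorm g (H y) (w v)) ` ?unit)"
  proof (rule bdd_aboveI2)
    fix v assume v: "v \<in> ?unit"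
    then have vt: "v \<in> tangent_space A y" by simp
    have "m * norm (v c) \<le> 1" using rnorm_lower[OF y vt] v by simp
    then have nv: "norm (v c) \<le> 1 / m" using pos by (simp add: field_simps)
    have "norm (w v c) \<le> norm (J (v c)) + norm (L v c)" unfolding w_c[OF vt] by (rule norm_triangle_ineq4)
    also have "norm (L v c) \<le> norm (v c) + norm (L v c - v c)" by (rule norm_triangle_sub)
    finally have "norm (w v c) \<le> (j + 1 + 2 * C * \<eta>) * norm (v c)"
      using j(2)[of "v c"] L_near[OF vt] by (simp add: algebra_simps)
    also have "\<dots> \<le> (j + 1 + 2 * C * \<eta>) * (1 / m)"
      using nv j(1) pos \<eta> by (intro mult_left_mono) auto
    finally have "M * norm (w v c) \<le> M * ((j + 1 + 2 * C * \<eta>) * (1 / m))"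
      using pos by (intro mult_left_mono) auto
    then show "rnorm g (H y) (w v) \<le> M * ((j + 1 + 2 * C * \<eta>) * (1 / m))"
      using rnorm_upper[OF Hy w_tan[OF vt]] by linarith
  qed
  have lt: "rnorm g (H y) (w v) < \<delta>" if "v \<in> ?unit" for v
    using cSUP_upper[OF that bdd] op unfolding op_norm_def w_def by linarith
  show ?thesis
  proof (cases "u = 0")
    case True
    then show ?thesis using J.zero by (simp add: J_def)
  next
    case False
    \<comment> \<open>The bound \<open>\<delta>\<close> concerns the unit ball and \<open>L\<close> need not be linear, so \<open>u\<close> is scaled before \<open>L\<close> is applied.\<close>
    define a where "a = M * norm u"
    define u' where "u' = (1 / a) *\<^sub>R u"
    have a: "a > 0" using False pos by (simp add: a_def)
    have nu': "norm u' = 1 / M" using False pos by (simp add: u'_def a_def)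
    define v where "v = tvector_of A c y u'"
    have vt: "v \<in> tangent_space A y" and vc: "v c = u'"
      using tvector_of_in_tangent_space[OF cy] tvector_of_coord[OF cy] by (auto simp: v_def)
    have "v \<in> ?unit" using rnorm_upper[OF y vt] vt vc nu' pos by simp
    then have "m * norm (w v c) \<le> \<delta>" using rnorm_lower[OF Hy w_tan[OF vt]] lt by fastforce
    then have "norm (J u' - L v c) \<le> \<delta> / m" using pos w_c[OF vt] vc by (simp add: field_simps)
    moreover have "norm (L v c - u') \<le> 2 * C * \<eta> * (1 / M)" using L_near[OF vt] vc nu' by simp
    ultimately have "norm (J u' - u') \<le> \<delta> / m + 2 * C * \<eta> * (1 / M)"
      using norm_triangle_ineq[of "J u' - L v c" "L v c - u'"] by simp
    then have "a * norm (J u' - u') \<le> a * (\<delta> / m + 2 * C * \<eta> * (1 / M))"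
      using a by (intro mult_left_mono) auto
    also have "\<dots> = (M * \<delta> / m + 2 * C * \<eta>) * norm u"
      using pos by (simp add: a_def field_simps)
    also have "a * norm (J u' - u') = norm (a *\<^sub>R (J u' - u'))" using a by simp
    also have "a *\<^sub>R (J u' - u') = J u - u"
      using a by (simp add: u'_def J.scaleR scaleR_diff_right)
    finally show ?thesis by (simp add: J_def)
  qed
qed

text \<open>
  The image under \<open>H\<close> of the segment from \<open>p\<^sub>0\<close> to \<open>p\<close> has coordinate speed at most \<open>2 * dist p\<^sub>0 p\<close> while
  it stays in the ball of radius \<open>\<rho>\<close>.
\<close>
lemma image_confined:
  assumes H: "differentiable_map A H" and "\<rho> \<le> r" and "\<rho>' \<le> r"
    and near: "\<And>q u. q \<in> ball p\<^sub>0 \<rho>' \<Longrightarrow> H (chart_inv c q) \<in> fst c \<Longrightarrow> snd c (H (chart_inv c q)) \<in> ball p\<^sub>0 \<rho>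
      \<Longrightarrow> norm (frechet_derivative (map_rep H c c) (at q) u - u) \<le> norm u"
    and H0: "H (chart_inv c p\<^sub>0) \<in> fst c"
    and p: "p \<in> ball p\<^sub>0 \<rho>'"
    and room: "dist p\<^sub>0 (snd c (H (chart_inv c p\<^sub>0))) + 2 * dist p\<^sub>0 p < \<rho>"
  shows "H (chart_inv c p) \<in> fst c" and "snd c (H (chart_inv c p)) \<in> ball p\<^sub>0 \<rho>"
proof -
  define s where "s t = p\<^sub>0 + t *\<^sub>R (p - p\<^sub>0)" for t
  define \<gamma> where "\<gamma> = H \<circ> (chart_inv c \<circ> s)"
  define \<sigma> where "\<sigma> = (\<lambda>t::real. 2 * norm (p - p\<^sub>0))"
  have s: "s t \<in> ball p\<^sub>0 \<rho>'" if "t \<in> {0..1}" for t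
  proof -
    have "p\<^sub>0 \<in> ball p\<^sub>0 \<rho>'" using p by (auto intro: le_less_trans[OF zero_le_dist])
    moreover have "s t = (1 - t) *\<^sub>R p\<^sub>0 + t *\<^sub>R p" by (simp add: s_def algebra_simps)
    ultimately show ?thesis using convexD[OF convex_ball _ p, of p\<^sub>0 "1 - t" t] that by auto
  qed
  have s_range: "s t \<in> snd c ` fst c" if "t \<in> {0..1}" for t
    using s[OF that] \<open>\<rho>' \<le> r\<close> ball_in_range by auto
  have s_der: "(s has_vector_derivative (p - p\<^sub>0)) (at t within S)" for t S
    unfolding s_def by (auto intro!: derivative_eq_intros)
  have "continuous_on {0..1} s" unfolding s_def by (intro continuous_intros)
  then have cont: "continuous_on {0..1} \<gamma>"
    unfolding \<gamma>_def
    by (intro continuous_on_compose continuous_on_subset[OF continuous_on_chart_inv[OF chart]]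
        continuous_on_subset[OF conjunct1[OF H[unfolded differentiable_map_def]] subset_UNIV])
      (use s_range in auto)
  have der: "\<exists>v. ((snd c \<circ> \<gamma>) has_vector_derivative v) (at t within {0..1}) \<and> norm v \<le> \<sigma> t"
    if t: "t \<in> {0..1}" and dom: "\<gamma> t \<in> fst c" and b: "snd c (\<gamma> t) \<in> ball p\<^sub>0 \<rho>" for t
  proof -
    let ?x = "chart_inv c (s t)"
    let ?J = "frechet_derivative (map_rep H c c) (at (s t))"
    have "c \<in> charts_at A ?x" "c \<in> charts_at A (H ?x)" and eq: "snd c ?x = s t"
      using chart dom chart_inv_in_domain[OF chart s_range[OF t]] chart_chart_inv[OF chart s_range[OF t]]
      by (auto simp: charts_at_def \<gamma>_def)
    from map_rep_has_derivative[OF H this(1,2)]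
    have "(map_rep H c c has_derivative ?J) (at (s t))" unfolding eq .
    from vector_derivative_diff_chain_within[OF s_der has_derivative_at_withinI[OF this]]
    have "((snd c \<circ> \<gamma>) has_vector_derivative ?J (p - p\<^sub>0)) (at t within {0..1})"
      unfolding \<gamma>_def map_rep_def comp_assoc .
    moreover have "norm (?J (p - p\<^sub>0)) \<le> norm (p - p\<^sub>0) + norm (?J (p - p\<^sub>0) - (p - p\<^sub>0))"
      by (rule norm_triangle_sub)
    then have "norm (?J (p - p\<^sub>0)) \<le> \<sigma> t"
      using near[OF s[OF t], of "p - p\<^sub>0"] dom b by (simp add: \<sigma>_def \<gamma>_def)
    ultimately show ?thesis by blast
  qed
  have start: "\<gamma> 0 \<in> fst c" using H0 by (simp add: \<gamma>_def s_def)
  have len: "dist p\<^sub>0 (snd c (\<gamma> 0)) + integral {0..1} \<sigma> < \<rho>"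
    using room by (simp add: \<gamma>_def s_def \<sigma>_def dist_norm norm_minus_commute)
  have ball: "ball p\<^sub>0 \<rho> \<subseteq> snd c ` fst c" using ball_in_range \<open>\<rho> \<le> r\<close> by auto
  have \<sigma>: "continuous_on {0..1} \<sigma>" "\<And>t. t \<in> {0..1} \<Longrightarrow> 0 \<le> \<sigma> t" by (auto simp: \<sigma>_def)
  have one: "(1::real) \<in> {0..1}" by simp
  note confined = curve_confined_to_chart_ball[OF chart ball cont start \<sigma>(1) _ _ len one]
  have "\<gamma> 1 \<in> fst c" by (rule confined(1)) (fact \<sigma>(2), rule der)
  moreover have "snd c (\<gamma> 1) \<in> ball p\<^sub>0 \<rho>" by (rule confined(2)) (fact \<sigma>(2), rule der)
  ultimately show "H (chart_inv c p) \<in> fst c" "snd c (H (chart_inv c p)) \<in> ball p\<^sub>0 \<rho>"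
    by (simp_all add: \<gamma>_def s_def)
qed

text \<open>
  Where \<open>H\<close> is defined in coordinates and how close its derivative is to the identity depend on each
  other: the derivative is controlled where the image lies in a small ball, and the image stays in the
  ball because the derivative is controlled. The radius \<open>\<rho>\<close> is found before the bound \<open>\<eta>\<close> for the
  displacement of the centre, since \<open>\<eta>\<close> will be chosen in terms of \<open>\<rho>\<close>.
\<close>
lemma map_near_identity:
  assumes \<epsilon>: "0 < \<epsilon>" "\<epsilon> \<le> 1" and U: "open U" "chart_inv c p\<^sub>0 \<in> U"
  shows "\<exists>\<rho>>0. \<rho> \<le> r \<and> (\<forall>\<eta>>0. \<exists>\<delta>>0. \<forall>H.
    differentiable_map A H \<and>
    (\<forall>y\<in>U. \<exists>L. is_parallel_transport A g y (H y) L \<and>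
       op_norm A g y (H y) (\<lambda>v d. differential A H y v d - L v d) < \<delta>) \<and>
    rdist A g (chart_inv c p\<^sub>0) (H (chart_inv c p\<^sub>0)) < ennreal \<delta> \<longrightarrow>
    norm (map_rep H c c p\<^sub>0 - p\<^sub>0) \<le> \<eta> \<and>
    (\<forall>p\<in>ball p\<^sub>0 \<rho>. H (chart_inv c p) \<in> fst c \<and>
       (map_rep H c c has_derivative frechet_derivative (map_rep H c c) (at p)) (at p) \<and>
       (\<forall>u. norm (frechet_derivative (map_rep H c c) (at p) u - u) \<le> \<epsilon> * norm u)))"
proof -
  define x\<^sub>0 where "x\<^sub>0 = chart_inv c p\<^sub>0"
  have p0: "p\<^sub>0 \<in> snd c ` fst c" using ball_in_range pos by auto
  have x0: "x\<^sub>0 \<in> fst c" "snd c x\<^sub>0 = p\<^sub>0"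
    unfolding x\<^sub>0_def using chart_inv_in_domain[OF chart p0] chart_chart_inv[OF chart p0] by auto
  have "open (snd c ` (fst c \<inter> U))" by (rule open_chart_image[OF chart U(1)])
  moreover have "p\<^sub>0 \<in> snd c ` (fst c \<inter> U)" using x0 U(2) unfolding x\<^sub>0_def by force
  ultimately obtain r\<^sub>U where rU: "r\<^sub>U > 0" "ball p\<^sub>0 r\<^sub>U \<subseteq> snd c ` (fst c \<inter> U)"
    by (meson open_contains_ball)
  \<comment> \<open>Bound for the coordinate length of the geodesics, making transport accurate up to \<open>\<epsilon> / 2\<close>.\<close>
  define \<eta>\<^sub>0 where "\<eta>\<^sub>0 = min (r / 2) (\<epsilon> / (4 * (C + 1)))"
  \<comment> \<open>Points of the ball of radius \<open>r\<^sub>1\<close> are at Riemannian distance at most \<open>m * \<eta>\<^sub>0\<close>.\<close>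
  define r\<^sub>1 where "r\<^sub>1 = min (min (r / 4) r\<^sub>U) (m * \<eta>\<^sub>0 / (2 * M))"
  have \<eta>0: "0 < \<eta>\<^sub>0" "\<eta>\<^sub>0 \<le> r / 2" using \<epsilon> pos unfolding \<eta>\<^sub>0_def by (simp, intro min.cobounded1)
  have "C * \<eta>\<^sub>0 \<le> (C + 1) * (\<epsilon> / (4 * (C + 1)))"
    using pos \<eta>0 by (intro mult_mono) (auto simp: \<eta>\<^sub>0_def)
  also have "\<dots> = \<epsilon> / 4" using pos by (simp add: add_nonneg_eq_0_iff divide_simps)
  finally have C\<eta>0: "C * \<eta>\<^sub>0 \<le> \<epsilon> / 4" .
  have r1: "0 < r\<^sub>1" "r\<^sub>1 \<le> r / 4" "r\<^sub>1 \<le> r\<^sub>U" using pos \<eta>0 rU by (auto simp: r\<^sub>1_def)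
  have "M * (2 * r\<^sub>1) \<le> M * (2 * (m * \<eta>\<^sub>0 / (2 * M)))"
    using pos by (intro mult_left_mono) (auto simp: r\<^sub>1_def)
  then have Mr1: "M * (2 * r\<^sub>1) \<le> m * \<eta>\<^sub>0" using pos by simp
  show ?thesis
  proof (rule exI[of _ "r\<^sub>1 / 4"], intro conjI allI impI)
    show "0 < r\<^sub>1 / 4" "r\<^sub>1 / 4 \<le> r" using r1 by auto
    fix \<eta> :: real assume \<eta>: "0 < \<eta>"
    \<comment> \<open>With \<open>\<delta> = m * \<tau>\<close>, the centre moves by at most \<open>\<tau>\<close> in coordinates.\<close>
    define \<tau> where "\<tau> = min (\<epsilon> / (2 * M)) (min (r\<^sub>1 / 4) \<eta>)"
    have \<tau>: "0 < \<tau>" "\<tau> \<le> \<epsilon> / (2 * M)" "\<tau> \<le> r\<^sub>1 / 4" "\<tau> \<le> \<eta>"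
      using pos \<epsilon> r1 \<eta> by (auto simp: \<tau>_def)
    have M\<tau>: "M * (m * \<tau>) / m \<le> \<epsilon> / 2" using \<tau>(2) pos by (simp add: field_simps)
    show "\<exists>\<delta>>0. \<forall>H.
      differentiable_map A H \<and>
      (\<forall>y\<in>U. \<exists>L. is_parallel_transport A g y (H y) L \<and>
         op_norm A g y (H y) (\<lambda>v d. differential A H y v d - L v d) < \<delta>) \<and>
      rdist A g (chart_inv c p\<^sub>0) (H (chart_inv c p\<^sub>0)) < ennreal \<delta> \<longrightarrow>
      norm (map_rep H c c p\<^sub>0 - p\<^sub>0) \<le> \<eta> \<and>
      (\<forall>p\<in>ball p\<^sub>0 (r\<^sub>1 / 4). H (chart_inv c p) \<in> fst c \<and>
         (map_rep H c c has_derivative frechet_derivative (map_rep H c c) (at p)) (at p) \<and>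
         (\<forall>u. norm (frechet_derivative (map_rep H c c) (at p) u - u) \<le> \<epsilon> * norm u))"
    proof (rule exI[of _ "m * \<tau>"], intro conjI allI impI)
      show "0 < m * \<tau>" using pos \<tau> by simp
      fix H
      assume "differentiable_map A H \<and>
        (\<forall>y\<in>U. \<exists>L. is_parallel_transport A g y (H y) L \<and>
           op_norm A g y (H y) (\<lambda>v d. differential A H y v d - L v d) < m * \<tau>) \<and>
        rdist A g (chart_inv c p\<^sub>0) (H (chart_inv c p\<^sub>0)) < ennreal (m * \<tau>)"
      then have H: "differentiable_map A H"
        and L: "\<And>y. y \<in> U \<Longrightarrow> \<exists>L. is_parallel_transport A g y (H y) L \<and>
           op_norm A g y (H y) (\<lambda>v d. differential A H y v d - L v d) < m * \<tau>"
        and d0: "rdist A g x\<^sub>0 (H x\<^sub>0) \<le> ennreal (m * \<tau>)"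
        by (auto simp: x\<^sub>0_def)
      \<comment> \<open>The hypothesis at \<open>x\<^sub>0\<close> itself provides a minimizing geodesic to \<open>H x\<^sub>0\<close>.\<close>
      obtain \<gamma> where \<gamma>: "minimizing_geodesic A g x\<^sub>0 (H x\<^sub>0) \<gamma>"
        using L[of x\<^sub>0] U(2) unfolding is_parallel_transport_def x\<^sub>0_def by blast
      have \<gamma>1: "\<gamma> 1 = H x\<^sub>0" using \<gamma> by (simp add: minimizing_geodesic_def)
      have "dist p\<^sub>0 (snd c x\<^sub>0) + \<tau> < r" using x0 \<tau> r1 pos by simp
      note conf = short_geodesic_confined[OF \<gamma> x0(1) d0 less_imp_le[OF \<tau>(1)] this]
      have Hx0: "H x\<^sub>0 \<in> fst c" "dist p\<^sub>0 (snd c (H x\<^sub>0)) \<le> \<tau>"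
        using conf(1)[of 1] conf(3)[of 1] \<gamma>1 x0 by auto
      show "norm (map_rep H c c p\<^sub>0 - p\<^sub>0) \<le> \<eta>"
        using Hx0(2) \<tau>(4) by (simp add: map_rep_def x\<^sub>0_def dist_norm norm_minus_commute)
      have near: "norm (frechet_derivative (map_rep H c c) (at q) u - u) \<le> \<epsilon> * norm u"
        if q: "q \<in> ball p\<^sub>0 r\<^sub>1" and Hq: "H (chart_inv c q) \<in> fst c" "snd c (H (chart_inv c q)) \<in> ball p\<^sub>0 r\<^sub>1"
        for q u
      proof -
        define y where "y = chart_inv c q"
        have "q \<in> snd c ` (fst c \<inter> U)" using q r1(3) rU(2) by auto
        then have y: "y \<in> fst c" "snd c y = q" "y \<in> U"
          unfolding y_def using chart_inv_chart[OF chart] by auto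
        obtain L where L: "is_parallel_transport A g y (H y) L"
          "op_norm A g y (H y) (\<lambda>v d. differential A H y v d - L v d) < m * \<tau>"
          using L[OF y(3)] by blast
        have big: "ball p\<^sub>0 r\<^sub>1 \<subseteq> ball p\<^sub>0 r" using r1 pos by auto
        have "dist (snd c (H y)) q \<le> 2 * r\<^sub>1"
          using q Hq(2) dist_triangle[of "snd c (H y)" q p\<^sub>0] unfolding y_def by (simp add: dist_commute)
        then have "M * norm (snd c (H y) - snd c y) \<le> M * (2 * r\<^sub>1)"
          using pos y by (simp add: dist_norm)
        then have "M * norm (snd c (H y) - snd c y) \<le> m * \<eta>\<^sub>0" using Mr1 by linarith
        moreover have "dist p\<^sub>0 (snd c y) + \<eta>\<^sub>0 < r" using q y r1 \<eta>0 pos by simp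
        moreover have "C * \<eta>\<^sub>0 \<le> 1 / 2" using C\<eta>0 \<epsilon> by simp
        moreover have "snd c y \<in> ball p\<^sub>0 r" "H y \<in> fst c" "snd c (H y) \<in> ball p\<^sub>0 r"
          using q y Hq big unfolding y_def by auto
        ultimately have "norm (frechet_derivative (map_rep H c c) (at q) u - u)
            \<le> (M * (m * \<tau>) / m + 2 * C * \<eta>\<^sub>0) * norm u"
          using map_derivative_near_identity[OF H y(1) _ _ _ L, of \<eta>\<^sub>0 u] y(2) by simp
        also have "\<dots> \<le> \<epsilon> * norm u"
          using M\<tau> C\<eta>0 by (intro mult_right_mono) auto
        finally show ?thesis .
      qed
      have conf: "H (chart_inv c p) \<in> fst c" "snd c (H (chart_inv c p)) \<in> ball p\<^sub>0 r\<^sub>1"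
        if p: "p \<in> ball p\<^sub>0 (r\<^sub>1 / 4)" for p
      proof -
        have le: "r\<^sub>1 \<le> r" "p \<in> ball p\<^sub>0 r\<^sub>1" using r1 pos p by auto
        have room: "dist p\<^sub>0 (snd c (H (chart_inv c p\<^sub>0))) + 2 * dist p\<^sub>0 p < r\<^sub>1"
          using Hx0(2) \<tau>(3) p r1 unfolding x\<^sub>0_def by simp
        have near1: "norm (frechet_derivative (map_rep H c c) (at q) u - u) \<le> norm u"
          if "q \<in> ball p\<^sub>0 r\<^sub>1" "H (chart_inv c q) \<in> fst c" "snd c (H (chart_inv c q)) \<in> ball p\<^sub>0 r\<^sub>1" for q u
          using near[OF that, of u] mult_right_mono[OF \<epsilon>(2) norm_ge_zero[of u]] by simp
        show "H (chart_inv c p) \<in> fst c" "snd c (H (chart_inv c p)) \<in> ball p\<^sub>0 r\<^sub>1"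
          using image_confined[OF H le(1) le(1) near1 Hx0(1)[unfolded x\<^sub>0_def] le(2) room] by blast+
      qed
      show "\<forall>p\<in>ball p\<^sub>0 (r\<^sub>1 / 4). H (chart_inv c p) \<in> fst c \<and>
         (map_rep H c c has_derivative frechet_derivative (map_rep H c c) (at p)) (at p) \<and>
         (\<forall>u. norm (frechet_derivative (map_rep H c c) (at p) u - u) \<le> \<epsilon> * norm u)"
      proof (intro ballI conjI allI)
        fix p assume p: "p \<in> ball p\<^sub>0 (r\<^sub>1 / 4)"
        show Hp: "H (chart_inv c p) \<in> fst c" by (rule conf(1)[OF p])
        have pE: "p \<in> snd c ` fst c" using p ball_in_range r1 pos by auto
        have "c \<in> charts_at A (chart_inv c p)" "c \<in> charts_at A (H (chart_inv c p))"
          using Hp chart chart_inv_in_domain[OF chart pE] by (auto simp: charts_at_def)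
        from map_rep_has_derivative[OF H this]
        show "(map_rep H c c has_derivative frechet_derivative (map_rep H c c) (at p)) (at p)"
          unfolding chart_chart_inv[OF chart pE] .
        show "norm (frechet_derivative (map_rep H c c) (at p) u - u) \<le> \<epsilon> * norm u" for u
          by (rule near) (use p conf[OF p] r1 in auto)
      qed
    qed
  qed
qed

end

section \<open>Fixed points of the composition\<close>

context controlled_chart_ball
begin

text \<open>
  In coordinates \<open>H \<circ> G\<close> has a derivative close to that of \<open>G\<close> at \<open>x\<^sub>0\<close>, since the derivative of \<open>H\<close> is
  close to the identity and that of \<open>G\<close> is continuous; \<open>\<epsilon>\<^sub>H\<close> and \<open>\<epsilon>\<^sub>G\<close> are their shares of the tolerance
  \<open>\<epsilon>\<close>.
\<close>
lemma perturbation_has_fixed_point: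
  assumes G: "C1_map A G" and G0: "G x\<^sub>0 = x\<^sub>0" and x0: "x\<^sub>0 \<in> fst c" "snd c x\<^sub>0 = p\<^sub>0"
    and K: "\<And>h. h \<in> tangent_space A x\<^sub>0 \<Longrightarrow> rnorm g x\<^sub>0 h = 1
           \<Longrightarrow> g x\<^sub>0 h (differential A G x\<^sub>0 h) \<le> K" "K < 1"
    and U: "open U" "x\<^sub>0 \<in> U"
  shows "\<exists>\<delta>>0. \<forall>H. differentiable_map A H \<and>
           (\<forall>y\<in>U. \<exists>L. is_parallel_transport A g y (H y) L \<and>
              op_norm A g y (H y) (\<lambda>v d. differential A H y v d - L v d) < \<delta>) \<and>
           rdist A g x\<^sub>0 (H x\<^sub>0) < ennreal \<delta>
           \<longrightarrow> (\<exists>x. H (G x) = x)"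
proof -
  have Gd: "differentiable_map A G" by (rule C1_map_imp_differentiable_map[OF G])
  have c0: "c \<in> charts_at A x\<^sub>0" using chart x0 by (simp add: charts_at_def)
  have inv0: "chart_inv c p\<^sub>0 = x\<^sub>0" using chart_inv_chart[OF chart x0(1)] x0(2) by simp
  define D\<^sub>0 where "D\<^sub>0 = snd c ` (fst c \<inter> G -` fst c)"
  have D0: "open D\<^sub>0" "p\<^sub>0 \<in> D\<^sub>0"
    using open_map_domain[OF Gd chart chart] x0 G0 by (force simp: D\<^sub>0_def)+
  from conjunct2[OF G[unfolded C1_map_def], THEN bspec, OF chart, THEN bspec, OF chart]
  obtain DG :: "'h \<Rightarrow> 'h \<Rightarrow>\<^sub>L 'h" where DGc: "continuous_on D\<^sub>0 DG" and
    DG: "\<And>p. p \<in> D\<^sub>0 \<Longrightarrow> (map_rep G c c has_derivative blinfun_apply (DG p)) (at p)"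
    unfolding D\<^sub>0_def by blast
  define T where "T = DG p\<^sub>0"
  obtain B B' where
    B: "\<And>x v w. x \<in> fst c \<Longrightarrow> v \<in> tangent_space A x \<Longrightarrow> w \<in> tangent_space A x
           \<Longrightarrow> g x v w = blinfun_apply (blinfun_apply (B (snd c x)) (v c)) (w c)" and
    Bsym: "\<And>p u v. p \<in> snd c ` fst c \<Longrightarrow> blinfun_apply (blinfun_apply (B p) u) v = blinfun_apply (blinfun_apply (B p) v) u" and
    coercive: "\<And>p. p \<in> snd c ` fst c \<Longrightarrow> \<exists>k>0. \<forall>u. k * (norm u)\<^sup>2 \<le> B p u u"
    by (rule metric_in_chart[OF chart]) blast
  have p0: "p\<^sub>0 \<in> snd c ` fst c" using x0 by force
  obtain k where k: "k > 0" "\<And>u. k * (norm u)\<^sup>2 \<le> B p\<^sub>0 u u" using coercive[OF p0] by blast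
  interpret b: equivalent_inner_product "B p\<^sub>0" k
    by unfold_locales (use k Bsym[OF p0] in auto)
  \<comment> \<open>The hypothesis on \<open>dG\<close> concerns unit vectors; both sides are homogeneous of degree 2.\<close>
  have bT: "B p\<^sub>0 u (T u) \<le> K * B p\<^sub>0 u u" for u
  proof (cases "u = 0")
    case False
    then have n: "b.bnorm u > 0" using b.bnorm_nonneg[of u] b.bnorm_eq_0[of u] by linarith
    define a where "a = 1 / b.bnorm u"
    define h where "h = tvector_of A c x\<^sub>0 (a *\<^sub>R u)"
    have h: "h \<in> tangent_space A x\<^sub>0" "h c = a *\<^sub>R u"
      using tvector_of_in_tangent_space[OF c0] tvector_of_coord[OF c0] by (auto simp: h_def)
    have dG: "differential A G x\<^sub>0 h c = T (h c)" "differential A G x\<^sub>0 h \<in> tangent_space A x\<^sub>0"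
      using differential_coord[OF Gd c0 _ h(1), of c] differential_in_tangent_space[OF Gd h(1)] G0 c0
        frechet_derivative_at[OF DG[OF D0(2)]] x0 by (simp_all add: T_def)
    have "rnorm g x\<^sub>0 h = b.bnorm (a *\<^sub>R u)"
      using B[OF x0(1) h(1) h(1)] x0 h by (simp add: rnorm_def b.bnorm_def)
    also have "\<dots> = 1" using n by (simp add: b.bnorm_scaleR a_def)
    finally have "g x\<^sub>0 h (differential A G x\<^sub>0 h) \<le> K" by (rule K(1)[OF h(1)])
    then have "B p\<^sub>0 (a *\<^sub>R u) (T (a *\<^sub>R u)) \<le> K"
      using B[OF x0(1) h(1) dG(2)] dG x0 h by simp
    then have "a\<^sup>2 * B p\<^sub>0 u (T u) \<le> K"
      by (simp add: blinfun.bilinear_simps power2_eq_square mult_ac)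
    then have "B p\<^sub>0 u (T u) \<le> K * (b.bnorm u)\<^sup>2"
      using n by (simp add: a_def power_one_over field_simps)
    then show ?thesis by (simp add: b.bnorm_sq)
  qed (simp add: blinfun.bilinear_simps)
  obtain \<epsilon> where \<epsilon>: "\<epsilon> > 0" and fix_pt: "\<And>\<rho>. \<rho> > 0 \<Longrightarrow> \<exists>\<eta>>0. \<forall>F F' p.
    (\<forall>x\<in>cball p \<rho>. (F has_derivative F' x) (at x) \<and> (\<forall>u. norm (F' x u - T u) \<le> \<epsilon> * norm u))
    \<and> norm (F p - p) \<le> \<eta> \<longrightarrow> (\<exists>x\<in>cball p \<rho>. F x = x)"
    using b.fixed_point_if_derivative_near[OF blinfun.bounded_linear_right bT K(2)] by blast
  define \<epsilon>\<^sub>G where "\<epsilon>\<^sub>G = min 1 (\<epsilon> / 2)"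
  define \<epsilon>\<^sub>H where "\<epsilon>\<^sub>H = min 1 (\<epsilon> / (2 * (norm T + 1)))"
  have nT: "0 < norm T + 1" by (simp add: add_nonneg_pos)
  have \<epsilon>G: "0 < \<epsilon>\<^sub>G" "\<epsilon>\<^sub>G \<le> 1" "\<epsilon>\<^sub>G \<le> \<epsilon> / 2" using \<epsilon> by (auto simp: \<epsilon>\<^sub>G_def)
  have \<epsilon>H: "0 < \<epsilon>\<^sub>H" "\<epsilon>\<^sub>H \<le> 1" using \<epsilon> nT by (auto simp: \<epsilon>\<^sub>H_def)
  have "\<epsilon>\<^sub>H \<le> \<epsilon> / (2 * (norm T + 1))" by (simp add: \<epsilon>\<^sub>H_def)
  then have \<epsilon>HT: "\<epsilon>\<^sub>H * (norm T + 1) \<le> \<epsilon> / 2" using nT by (simp add: field_simps)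
  obtain \<rho>\<^sub>H where \<rho>H: "\<rho>\<^sub>H > 0" and near: "\<And>\<eta>. \<eta> > 0 \<Longrightarrow> \<exists>\<delta>>0. \<forall>H.
    differentiable_map A H \<and>
    (\<forall>y\<in>U. \<exists>L. is_parallel_transport A g y (H y) L \<and>
       op_norm A g y (H y) (\<lambda>v d. differential A H y v d - L v d) < \<delta>) \<and>
    rdist A g x\<^sub>0 (H x\<^sub>0) < ennreal \<delta> \<longrightarrow>
    norm (map_rep H c c p\<^sub>0 - p\<^sub>0) \<le> \<eta> \<and>
    (\<forall>p\<in>ball p\<^sub>0 \<rho>\<^sub>H. H (chart_inv c p) \<in> fst c \<and>
       (map_rep H c c has_derivative frechet_derivative (map_rep H c c) (at p)) (at p) \<and>
       (\<forall>u. norm (frechet_derivative (map_rep H c c) (at p) u - u) \<le> \<epsilon>\<^sub>H * norm u))"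
    using map_near_identity[OF \<epsilon>H U(1)] U(2) unfolding inv0 by blast
  let ?G = "map_rep G c c"
  have G0': "?G p\<^sub>0 = p\<^sub>0" using inv0 G0 x0 by (simp add: map_rep_def)
  have "isCont DG p\<^sub>0" using DGc continuous_on_eq_continuous_at[OF D0(1)] D0(2) by blast
  then obtain d1 where d1: "d1 > 0" "\<And>p. dist p p\<^sub>0 < d1 \<Longrightarrow> dist (DG p) (DG p\<^sub>0) < \<epsilon>\<^sub>G"
    unfolding continuous_at_eps_delta using \<epsilon>G(1) by blast
  have "isCont ?G p\<^sub>0" using DG[OF D0(2)] has_derivative_continuous by blast
  then obtain d2 where d2: "d2 > 0" "\<And>p. dist p p\<^sub>0 < d2 \<Longrightarrow> dist (?G p) (?G p\<^sub>0) < \<rho>\<^sub>H"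
    unfolding continuous_at_eps_delta using \<rho>H by blast
  obtain d3 where d3: "d3 > 0" "ball p\<^sub>0 d3 \<subseteq> D\<^sub>0" using D0 by (meson open_contains_ball)
  define \<rho> where "\<rho> = min d1 (min d2 d3) / 2"
  have \<rho>: "\<rho> > 0" using d1 d2 d3 by (simp add: \<rho>_def)
  have G_near: "norm (DG p - T) \<le> \<epsilon>\<^sub>G" "?G p \<in> ball p\<^sub>0 \<rho>\<^sub>H" "p \<in> D\<^sub>0" if "p \<in> cball p\<^sub>0 \<rho>" for p
  proof -
    have lt: "dist p p\<^sub>0 < d1" "dist p p\<^sub>0 < d2" "dist p\<^sub>0 p < d3"
      using that d1 d2 d3 by (auto simp: \<rho>_def dist_commute min_def split: if_splits)
    show "norm (DG p - T) \<le> \<epsilon>\<^sub>G" using d1(2)[OF lt(1)] by (simp add: T_def dist_norm)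
    show "?G p \<in> ball p\<^sub>0 \<rho>\<^sub>H" using d2(2)[OF lt(2)] G0' by (simp add: dist_commute)
    show "p \<in> D\<^sub>0" using d3(2) lt(3) by auto
  qed
  obtain \<eta> where \<eta>: "\<eta> > 0" and fix_pt\<rho>: "\<And>F F' p.
    \<forall>x\<in>cball p \<rho>. (F has_derivative F' x) (at x) \<and> (\<forall>u. norm (F' x u - T u) \<le> \<epsilon> * norm u)
    \<Longrightarrow> norm (F p - p) \<le> \<eta> \<Longrightarrow> \<exists>x\<in>cball p \<rho>. F x = x"
    using fix_pt[OF \<rho>] by blast
  obtain \<delta> where \<delta>: "\<delta> > 0" and near\<delta>: "\<forall>H.
    differentiable_map A H \<and>
    (\<forall>y\<in>U. \<exists>L. is_parallel_transport A g y (H y) L \<and>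
       op_norm A g y (H y) (\<lambda>v d. differential A H y v d - L v d) < \<delta>) \<and>
    rdist A g x\<^sub>0 (H x\<^sub>0) < ennreal \<delta> \<longrightarrow>
    norm (map_rep H c c p\<^sub>0 - p\<^sub>0) \<le> \<eta> \<and>
    (\<forall>p\<in>ball p\<^sub>0 \<rho>\<^sub>H. H (chart_inv c p) \<in> fst c \<and>
       (map_rep H c c has_derivative frechet_derivative (map_rep H c c) (at p)) (at p) \<and>
       (\<forall>u. norm (frechet_derivative (map_rep H c c) (at p) u - u) \<le> \<epsilon>\<^sub>H * norm u))"
    using near[OF \<eta>] by blast
  show ?thesis
  proof (rule exI[of _ \<delta>], intro conjI allI impI \<delta>)
    fix H
    assume "differentiable_map A H \<and>
      (\<forall>y\<in>U. \<exists>L. is_parallel_transport A g y (H y) L \<and>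
         op_norm A g y (H y) (\<lambda>v d. differential A H y v d - L v d) < \<delta>) \<and>
      rdist A g x\<^sub>0 (H x\<^sub>0) < ennreal \<delta>"
    from near\<delta>[THEN spec, THEN mp, OF this]
    have H0: "norm (map_rep H c c p\<^sub>0 - p\<^sub>0) \<le> \<eta>"
      and H: "\<And>p. p \<in> ball p\<^sub>0 \<rho>\<^sub>H \<Longrightarrow> H (chart_inv c p) \<in> fst c"
      and dH: "\<And>p. p \<in> ball p\<^sub>0 \<rho>\<^sub>H \<Longrightarrow>
        (map_rep H c c has_derivative frechet_derivative (map_rep H c c) (at p)) (at p)"
      and JH: "\<And>p u. p \<in> ball p\<^sub>0 \<rho>\<^sub>H \<Longrightarrow>
        norm (frechet_derivative (map_rep H c c) (at p) u - u) \<le> \<epsilon>\<^sub>H * norm u"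
      by blast+
    define F where "F = map_rep H c c \<circ> ?G"
    define F' where "F' p = frechet_derivative (map_rep H c c) (at (?G p)) \<circ> blinfun_apply (DG p)" for p
    have "(F has_derivative F' p) (at p)" if "p \<in> cball p\<^sub>0 \<rho>" for p
      unfolding F_def F'_def by (rule diff_chain_at[OF DG[OF G_near(3)[OF that]] dH[OF G_near(2)[OF that]]])
    moreover have "norm (F' p u - T u) \<le> \<epsilon> * norm u" if p: "p \<in> cball p\<^sub>0 \<rho>" for p u
    proof -
      have 1: "norm (DG p u - T u) \<le> \<epsilon>\<^sub>G * norm u"
      proof -
        have "norm (DG p u - T u) \<le> norm (DG p - T) * norm u"
          using norm_blinfun[of "DG p - T" u] by (simp add: blinfun.diff_left)
        also have "\<dots> \<le> \<epsilon>\<^sub>G * norm u" by (intro mult_right_mono G_near(1)[OF p]) simp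
        finally show ?thesis .
      qed
      have "norm (DG p u) \<le> norm (T u) + norm (DG p u - T u)" by (rule norm_triangle_sub)
      also have "\<dots> \<le> norm T * norm u + 1 * norm u"
        using 1 mult_right_mono[OF \<epsilon>G(2) norm_ge_zero[of u]] norm_blinfun[of T u] by linarith
      finally have 2: "norm (DG p u) \<le> (norm T + 1) * norm u" by (simp add: distrib_right)
      have "norm (F' p u - T u) \<le> norm (F' p u - DG p u) + norm (DG p u - T u)"
        using norm_triangle_ineq[of "F' p u - DG p u" "DG p u - T u"] by simp
      also have "norm (F' p u - DG p u) \<le> \<epsilon>\<^sub>H * norm (DG p u)"
        unfolding F'_def using JH[OF G_near(2)[OF p], of "DG p u"] by simp
      also have "\<epsilon>\<^sub>H * norm (DG p u) \<le> \<epsilon>\<^sub>H * ((norm T + 1) * norm u)"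
        using \<epsilon>H 2 by (intro mult_left_mono) auto
      also have "\<dots> \<le> \<epsilon> / 2 * norm u"
        using mult_right_mono[OF \<epsilon>HT norm_ge_zero[of u]] by (simp add: mult_ac)
      also have "norm (DG p u - T u) \<le> \<epsilon> / 2 * norm u"
        using 1 mult_right_mono[OF \<epsilon>G(3) norm_ge_zero[of u]] by linarith
      finally show ?thesis by simp
    qed
    moreover have "norm (F p\<^sub>0 - p\<^sub>0) \<le> \<eta>" using H0 G0' by (simp add: F_def)
    ultimately obtain p where p: "p \<in> cball p\<^sub>0 \<rho>" "F p = p"
      using fix_pt\<rho>[of p\<^sub>0 F F'] by blast
    define x where "x = chart_inv c p"
    have Gx: "G x \<in> fst c"
      using G_near(3)[OF p(1)] chart_inv_chart[OF chart] by (auto simp: D\<^sub>0_def x_def)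
    have eq: "chart_inv c (?G p) = G x"
      using chart_inv_chart[OF chart Gx] by (simp add: map_rep_def x_def)
    have HGx: "H (G x) \<in> fst c" using H[OF G_near(2)[OF p(1)]] eq by simp
    have "snd c (H (G x)) = p" using p(2) eq by (simp add: F_def map_rep_def)
    then have "H (G x) = x" using chart_inv_chart[OF chart HGx] by (simp add: x_def)
    then show "\<exists>x. H (G x) = x" by blast
  qed
qed

end

theorem theorem50:
  fixes A :: "('m::t2_space, 'h::{real_inner,banach}) chart set"
    and g :: "('m, 'h) metric"
    and G :: "'m \<Rightarrow> 'm"
    and x\<^sub>0 :: 'm
    and K :: real
    and U :: "'m set"
  assumes "complete_riemannian_manifold A g"
    and "C1_map A G"
    and "G x\<^sub>0 = x\<^sub>0"
    and "\<And>h. h \<in> tangent_space A x\<^sub>0 \<Longrightarrow> rnorm g x\<^sub>0 h = 1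
           \<Longrightarrow> g x\<^sub>0 h (differential A G x\<^sub>0 h) \<le> K"
    and "K < 1"
    and "open U" and "x\<^sub>0 \<in> U"
  shows "\<exists>\<delta>>0. \<forall>H :: 'm \<Rightarrow> 'm.
           differentiable_map A H \<and>
           (\<forall>y\<in>U. \<exists>L. is_parallel_transport A g y (H y) L \<and>
              op_norm A g y (H y) (\<lambda>v c. differential A H y v c - L v c) < \<delta>) \<and>
           rdist A g x\<^sub>0 (H x\<^sub>0) < ennreal \<delta>
           \<longrightarrow> (\<exists>x. (H \<circ> G) x = x)"
proof -
  interpret riemannian A g
    using assms(1) by unfold_locales (simp add: complete_riemannian_manifold_def)
  obtain c where "c \<in> charts_at A x\<^sub>0" using charts_at_nonempty by blast
  note c = charts_atD[OF this]
  obtain r m M C where "controlled_chart_ball A g c (snd c x\<^sub>0) r m M C"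
    using controlled_chart_ball_exists[OF c] by blast
  from controlled_chart_ball.perturbation_has_fixed_point[OF this assms(2,3) c(2) refl assms(4-7)]
  show ?thesis by simp
qed

end
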